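(* Let $n\ge1$. Then $\Theta_{\mathbb Z^n}=\theta_3^n$; $\Theta_{\mathbb Z^n,P}=0$ for all $P\in\mathrm{Harm}_2(\mathbb R^n)$; there is a linear form $c_1$ on $\mathrm{Harm}_4(\mathbb R^n)$ with $\Theta_{\mathbb Z^n,P}=c_1(P)\,\Delta_8\theta_3^n$ for all $P\in\mathrm{Harm}_4(\mathbb R^n)$; and there is a linear form $c_2$ on $\mathrm{Harm}_6(\mathbb R^n)$ with $\Theta_{\mathbb Z^n,P}=c_2(P)\,\varphi\,\Delta_8\theta_3^n$ for all $P\in\mathrm{Harm}_6(\mathbb R^n)$. Moreover $c_1\neq0$ if and only if $n\ge2$, and $c_2\ne0$ if and only if $n\ge3$.
   Context: $\mathbb Z^n$ is the cubic lattice in $\mathbb R^n$. $\mathrm{Harm}_j(\mathbb R^n)$ is the space of homogeneous harmonic polynomials of degree $j$. With $q=e^{i\pi z}$ ($\operatorname{Im}z>0$): $\theta_2=\sum_{m\in\mathbb Z+1/2}q^{m^2}$, $\theta_3=\sum_{m\in\mathbb Z}q^{m^2}$, $\theta_4=\sum_{m\in\mathbb Z}(-q)^{m^2}$, $\Delta_8=\tfrac1{16}\theta_2^4\theta_4^4$, $\varphi=\theta_4^4-\theta_2^4$. For a polynomial $P$, $\Theta_{\Lambda,P}(z)=\sum_{x\in\Lambda}P(x)q^{\langle x,x\rangle}$ and $\Theta_\Lambda=\Theta_{\Lambda,1}$. *)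

theory Defs
  imports "HOL-Analysis.Analysis"
begin

text \<open>The nome power: q^r with q = exp(i pi z), i.e. exp(i pi z r), for real r.\<close>
definition qpow :: "complex \<Rightarrow> real \<Rightarrow> complex" where
  "qpow z r = exp (\<i> * of_real pi * z * of_real r)"

definition theta2 :: "complex \<Rightarrow> complex" where
  "theta2 z = infsum (\<lambda>m::int. qpow z ((of_int m + 1/2)^2)) UNIV"

definition theta3 :: "complex \<Rightarrow> complex" where
  "theta3 z = infsum (\<lambda>m::int. qpow z (of_int m ^ 2)) UNIV"

text \<open>(-q)^(m^2) = (-1)^(m^2) q^(m^2), m^2 a nonnegative integer.\<close>
definition theta4 :: "complex \<Rightarrow> complex" where
  "theta4 z = infsum (\<lambda>m::int. (-1) ^ nat (m^2) * qpow z (of_int m ^ 2)) UNIV"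

definition Delta8 :: "complex \<Rightarrow> complex" where
  "Delta8 z = (1/16) * theta2 z ^ 4 * theta4 z ^ 4"

definition varphi :: "complex \<Rightarrow> complex" where
  "varphi z = theta4 z ^ 4 - theta2 z ^ 4"

definition cubic_lattice :: "(real ^ 'n) set" where
  "cubic_lattice = {x. \<forall>i. x $ i \<in> \<int>}"

definition theta_series :: "(real ^ 'n) set \<Rightarrow> (real ^ 'n \<Rightarrow> real) \<Rightarrow> complex \<Rightarrow> complex" where
  "theta_series L P z = infsum (\<lambda>x. of_real (P x) * qpow z (x \<bullet> x)) L"

definition homog_poly :: "nat \<Rightarrow> (real ^ 'n \<Rightarrow> real) \<Rightarrow> bool" where
  "homog_poly j P \<longleftrightarrow> (\<exists>c :: ('n \<Rightarrow> nat) \<Rightarrow> real.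
     P = (\<lambda>x. \<Sum>\<alpha>\<in>{\<alpha>. sum \<alpha> UNIV = j}. c \<alpha> * (\<Prod>i\<in>UNIV. (x $ i) ^ \<alpha> i)))"

definition laplacian :: "(real ^ 'n \<Rightarrow> real) \<Rightarrow> real ^ 'n \<Rightarrow> real" where
  "laplacian P x = (\<Sum>i\<in>UNIV.
     deriv (\<lambda>s. deriv (\<lambda>t. P (x + t *\<^sub>R axis i 1)) s) 0)"

definition Harm :: "nat \<Rightarrow> (real ^ 'n \<Rightarrow> real) set" where
  "Harm j = {P. homog_poly j P \<and> (\<forall>x. laplacian P x = 0)}"

definition linear_form_on :: "(real ^ 'n \<Rightarrow> real) set \<Rightarrow> ((real ^ 'n \<Rightarrow> real) \<Rightarrow> real) \<Rightarrow> bool" where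
  "linear_form_on V c \<longleftrightarrow> (\<forall>P\<in>V. \<forall>Q\<in>V. \<forall>a b. c (\<lambda>x. a * P x + b * Q x) = a * c P + b * c Q)"

end

theory Submission
  imports Defs "HOL-Real_Asymp.Real_Asymp"
begin

text \<open>
  Write \<open>D = q d/dq\<close> and \<open>t\<^sub>i = D \<theta>\<^sub>i / \<theta>\<^sub>i\<close>. Splitting \<open>\<int>\<^sup>2\<close> and \<open>(\<int> + 1/2)\<^sup>2\<close> by the
  similarity \<open>(u, v) \<mapsto> (u + v, u - v)\<close> of norm 2 expresses quadratic expressions in the
  \<open>D\<^sup>k \<theta>\<^sub>i\<close> at \<open>z\<close> through their values at \<open>2 z\<close>. Hence, for \<open>\<theta>\<^sub>1' = \<Sum> (-1)\<^sup>m (m + 1/2) q^((m + 1/2)\<^sup>2)\<close>, the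
  quotient \<open>4 \<theta>\<^sub>1'\<^sup>2 / (\<theta>\<^sub>2 \<theta>\<^sub>3 \<theta>\<^sub>4)\<^sup>2\<close> is invariant under \<open>z \<mapsto> 2 z\<close>, so it equals its limit 1 at \<open>i \<infinity>\<close>.
  This yields \<open>t\<^sub>3 - t\<^sub>4 = \<theta>\<^sub>2\<^sup>4 / 4\<close> and \<open>t\<^sub>2 - t\<^sub>3 = \<theta>\<^sub>4\<^sup>4 / 4\<close>. Next,
  \<open>e = D t\<^sub>3 - 2 t\<^sub>3\<^sup>2 - \<theta>\<^sub>2\<^sup>4 \<theta>\<^sub>4\<^sup>4 / 8\<close> satisfies \<open>e z = - 4 e (2 z)\<close> and decays exponentially, so it vanishes; this is
  the case of degree 4, and applying \<open>D\<close> to it gives the case of degree 6.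

  In dimension \<open>n\<close>, \<open>\<Theta>_P / \<theta>\<^sub>3\<^sup>n\<close> is the value on \<open>P\<close> of the product functional with one-dimensional moments
  \<open>s\<^sub>2\<^sub>k = D\<^sup>k \<theta>\<^sub>3 / \<theta>\<^sub>3\<close>. The Gaussian functional with the same variance kills every harmonic \<open>P\<close>, so
  only the higher cumulants of \<open>s\<close> contribute: \<open>\<kappa>\<^sub>4 = 2 \<Delta>\<^sub>8\<close> in degree 4 and \<open>\<kappa>\<^sub>6 = 2 \<phi> \<Delta>\<^sub>8\<close> in degree 6, each with
  coefficient \<open>\<Sum>\<^sub>i P(e\<^sub>i)\<close>, because the mixed term in \<open>\<kappa>\<^sub>4\<close> is a multiple of the Laplacian of \<open>P\<close> at the
  \<open>e\<^sub>i\<close>.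
\<close>

subsection \<open>Theta constants with polynomial weights\<close>

lemma norm_qpow: "norm (qpow z r) = exp (- (pi * Im z * r))"
  by (simp add: qpow_def norm_exp_eq_Re)

lemma qpow_add: "qpow z (r + s) = qpow z r * qpow z s"
  by (simp add: qpow_def exp_add [symmetric] ring_distribs)

lemma qpow_double: "qpow (2 * z) r = qpow z (2 * r)"
  by (simp add: qpow_def mult_ac)

lemma qpow_nonzero [simp]: "qpow z r \<noteq> 0"
  by (simp add: qpow_def)

lemma qpow_deriv:
  "((\<lambda>z. qpow z r) has_field_derivative \<i> * of_real pi * of_real r * qpow z r) (at z within S)"
  unfolding qpow_def by (auto intro!: derivative_eq_intros simp: mult_ac)

definition chi :: "complex \<Rightarrow> int \<Rightarrow> complex" where
  "chi s m = (if even m then 1 else s)"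

text \<open>The shift \<open>a\<close>, the sign \<open>s\<close> and the weight exponent
  \<open>k\<close> stay parameters so that convergence and differentiation are treated once for all
  theta constants; \<open>q d/dq\<close> raises \<open>k\<close> by 2.\<close>

definition th :: "real \<Rightarrow> complex \<Rightarrow> nat \<Rightarrow> complex \<Rightarrow> complex" where
  "th a s k z = (\<Sum>\<^sub>\<infinity>m::int. chi s m * of_real ((of_int m + a) ^ k) * qpow z ((of_int m + a)\<^sup>2))"

lemma norm_chi_le: "norm s \<le> 1 \<Longrightarrow> norm (chi s m) \<le> 1"
  by (simp add: chi_def)

lemma summable_on_int_inverse_square:
  "(\<lambda>m::int. 1 / (1 + (of_int m)\<^sup>2) :: real) summable_on UNIV"
proof -
  let ?f = "\<lambda>m::int. 1 / (1 + (of_int m)\<^sup>2) :: real"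
  have s: "summable (\<lambda>n. 1 / (1 + (real n)\<^sup>2))"
  proof (rule summable_comparison_test_ev)
    show "\<forall>\<^sub>F n in sequentially. norm (1 / (1 + (real n)\<^sup>2)) \<le> 1 / (real n)\<^sup>2"
      using eventually_gt_at_top[of 0] by eventually_elim (auto intro!: divide_left_mono mult_pos_pos simp: add_pos_nonneg)
    show "summable (\<lambda>n. 1 / (real n)\<^sup>2)"
      using inverse_power_summable[of 2] by (simp add: inverse_eq_divide)
  qed
  have n: "(\<lambda>n. 1 / (1 + (real n)\<^sup>2)) summable_on UNIV"
    by (rule norm_summable_imp_summable_on) (use s in simp)
  have a: "?f summable_on (range int)"
    by (subst summable_on_reindex) (use n in \<open>auto simp: o_def\<close>)
  have b: "?f summable_on (range (\<lambda>n. - int n))"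
    by (subst summable_on_reindex) (use n in \<open>auto simp: o_def inj_on_def\<close>)
  have "?f summable_on (range (\<lambda>n. - int n) - range int)"
    by (rule summable_on_subset_banach[OF b]) auto
  then have "?f summable_on (range int \<union> (range (\<lambda>n. - int n) - range int))"
    by (intro summable_on_Un_disjoint a) auto
  also have "range int \<union> (range (\<lambda>n. - int n) - range int) = UNIV"
  proof -
    have "m \<in> range int \<union> range (\<lambda>n. - int n)" for m
      by (cases m rule: int_cases2) auto
    then show ?thesis by blast
  qed
  finally show ?thesis .
qed

text \<open>Apply u <= exp u to u = c (1 + x^2) / (k + 1) and raise it to the power k + 1; as |x| <=
  1 + x^2, one factor 1 + x^2 is left over to divide by.\<close>

lemma power_times_gaussian_bound:
  fixes x c :: real
  assumes "c > 0"
  shows "\<bar>x\<bar> ^ k * exp (- (c * x\<^sup>2)) \<le> (real (Suc k) / c) ^ Suc k * exp c * (1 / (1 + x\<^sup>2))"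
proof -
  define N where "N = real (Suc k)"
  have N: "N > 0" by (simp add: N_def)
  have "c * (1 + x\<^sup>2) / N \<le> exp (c * (1 + x\<^sup>2) / N)"
    using exp_ge_add_one_self[of "c * (1 + x\<^sup>2) / N"] by linarith
  then have "(c * (1 + x\<^sup>2) / N) ^ Suc k \<le> exp (c * (1 + x\<^sup>2) / N) ^ Suc k"
    using assms N by (intro power_mono) auto
  also have "\<dots> = exp (c * (1 + x\<^sup>2))"
    by (simp only: exp_of_nat_mult[symmetric] N_def) (simp add: field_simps)
  finally have 1: "(1 + x\<^sup>2) ^ Suc k \<le> (N / c) ^ Suc k * exp (c * (1 + x\<^sup>2))"
    using assms N by (simp add: power_divide power_mult_distrib pos_divide_le_eq pos_le_divide_eq mult_ac del: power_Suc)
  have "\<bar>x\<bar> \<le> 1 + x\<^sup>2"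
    using sum_squares_bound[of "\<bar>x\<bar>" 1] by (simp add: power2_eq_square)
  then have "\<bar>x\<bar> ^ k * (1 + x\<^sup>2) \<le> (1 + x\<^sup>2) ^ k * (1 + x\<^sup>2)"
    by (intro mult_right_mono power_mono) auto
  also have "\<dots> \<le> (N / c) ^ Suc k * exp (c * (1 + x\<^sup>2))"
    using 1 by (simp add: mult.commute)
  finally have "\<bar>x\<bar> ^ k * (1 + x\<^sup>2) * exp (- (c * x\<^sup>2)) \<le> (N / c) ^ Suc k * exp (c * (1 + x\<^sup>2)) * exp (- (c * x\<^sup>2))"
    by (intro mult_right_mono) auto
  also have "\<dots> = (N / c) ^ Suc k * exp c"
    by (simp add: mult.assoc exp_add[symmetric] distrib_left)
  finally have "\<bar>x\<bar> ^ k * exp (- (c * x\<^sup>2)) * (1 + x\<^sup>2) \<le> (N / c) ^ Suc k * exp c"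
    by (simp only: mult_ac)
  then have "\<bar>x\<bar> ^ k * exp (- (c * x\<^sup>2)) \<le> (N / c) ^ Suc k * exp c / (1 + x\<^sup>2)"
    by (subst pos_le_divide_eq) (auto simp: add_pos_nonneg)
  then show ?thesis
    unfolding N_def by simp
qed

lemma gaussian_summable:
  fixes c a :: real
  assumes "c > 0"
  shows "(\<lambda>m::int. \<bar>of_int m + a\<bar> ^ k * exp (- (c * (of_int m + a)\<^sup>2))) summable_on UNIV"
proof (rule summable_on_comparison_test)
  \<comment> \<open>The factor 2 + 2 a^2 pays for replacing 1 + (m + a)^2 by 1 + m^2 in the
    denominator.\<close>
  define K where "K = (real (Suc k) / c) ^ Suc k * exp c * (2 + 2 * a\<^sup>2)"
  show "(\<lambda>m::int. K * (1 / (1 + (of_int m)\<^sup>2))) summable_on UNIV"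
    by (intro summable_on_cmult_right summable_on_int_inverse_square)
  fix m :: int
  define x where "x = of_int m + a"
  have "1 + (of_int m)\<^sup>2 \<le> (2 + 2 * a\<^sup>2) * (1 + x\<^sup>2)"
  proof -
    have "(of_int m)\<^sup>2 = (x - a)\<^sup>2" by (simp add: x_def)
    also have "\<dots> \<le> 2 * x\<^sup>2 + 2 * a\<^sup>2"
      using zero_le_power2[of "x + a"] by (simp add: power2_eq_square algebra_simps)
    finally have "1 + (of_int m)\<^sup>2 \<le> 2 + 2 * x\<^sup>2 + 2 * a\<^sup>2" by simp
    also have "\<dots> \<le> (2 + 2 * a\<^sup>2) * (1 + x\<^sup>2)"
      by (simp add: algebra_simps)
    finally show ?thesis .
  qed
  then have "1 / (1 + x\<^sup>2) \<le> (2 + 2 * a\<^sup>2) * (1 / (1 + (of_int m)\<^sup>2))"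
    by (simp add: field_simps add_pos_nonneg)
  then have "(real (Suc k) / c) ^ Suc k * exp c * (1 / (1 + x\<^sup>2)) \<le> K * (1 / (1 + (of_int m)\<^sup>2))"
    unfolding K_def mult.assoc using assms by (intro mult_left_mono) auto
  with power_times_gaussian_bound[OF assms, of x k]
  show "\<bar>of_int m + a\<bar> ^ k * exp (- (c * (of_int m + a)\<^sup>2)) \<le> K * (1 / (1 + (of_int m)\<^sup>2))"
    by (simp add: x_def)
qed auto

lemma th_abs_summable:
  assumes "norm s \<le> 1" "Im z > 0"
  shows "(\<lambda>m::int. norm (chi s m * of_real ((of_int m + a) ^ k) * qpow z ((of_int m + a)\<^sup>2))) summable_on UNIV"
proof (rule Infinite_Sum.abs_summable_on_comparison_test')
  show "(\<lambda>m::int. \<bar>of_int m + a\<bar> ^ k * exp (- (pi * Im z * (of_int m + a)\<^sup>2))) summable_on UNIV"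
    using assms by (intro gaussian_summable) auto
  show "norm (chi s m * of_real ((of_int m + a) ^ k) * qpow z ((of_int m + a)\<^sup>2))
    \<le> \<bar>of_int m + a\<bar> ^ k * exp (- (pi * Im z * (of_int m + a)\<^sup>2))" for m
    using mult_right_mono[OF norm_chi_le[OF assms(1), of m], of "\<bar>of_int m + a\<bar> ^ k * exp (- (pi * Im z * (of_int m + a)\<^sup>2))"]
    by (simp add: norm_mult norm_power norm_qpow power_abs mult.assoc del: of_real_power of_real_add)
qed

lemma th_has_sum:
  assumes "norm s \<le> 1" "Im z > 0"
  shows "((\<lambda>m::int. chi s m * of_real ((of_int m + a) ^ k) * qpow z ((of_int m + a)\<^sup>2)) has_sum th a s k z) UNIV"
  unfolding th_def
  by (rule has_sum_infsum[OF abs_summable_summable[OF th_abs_summable[OF assms]]])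

text \<open>Termwise differentiation of the series, enumerated along \<open>int_decode\<close>. On
  the half-plane Im w > Im z / 2 the differentiated terms have a summable majorant independent of
  w.\<close>

lemma th_has_field_derivative:
  assumes s: "norm s \<le> 1" and z: "Im z > 0"
  shows "(th a s k has_field_derivative \<i> * of_real pi * th a s (k + 2) z) (at z)"
proof -
  define f where "f k = (\<lambda>m z. chi s m * of_real ((of_int m + a) ^ k) * qpow z ((of_int m + a)\<^sup>2))" for k
  define y where "y = Im z / 2"
  define S where "S = {w. Im w > y}"
  have y: "y > 0" and zS: "z \<in> S" using z by (auto simp: y_def S_def)
  have [simp]: "interior S = S"
    unfolding S_def by (rule interior_open) (rule open_halfspace_Im_gt)
  have pos: "Im w > 0" if "w \<in> S" for w using that y by (auto simp: S_def)
  have sums: "(\<lambda>n. f k (int_decode n) w) sums th a s k w" if "Im w > 0" for w k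
  proof -
    have "((\<lambda>n. f k (int_decode n) w) has_sum th a s k w) UNIV"
      using th_has_sum[OF s that, of a k] unfolding f_def
      by (subst has_sum_reindex_bij_betw[OF bij_int_decode])
    then show ?thesis by (rule has_sum_imp_sums)
  qed
  have "((\<lambda>w. \<Sum>n. f k (int_decode n) w) has_field_derivative (\<Sum>n. \<i> * of_real pi * f (k + 2) (int_decode n) z)) (at z)"
  proof (rule has_field_derivative_series'(2)[where S = S and x0 = z])
    show "convex S" unfolding S_def by (rule convex_halfspace_Im_gt)
    show "summable (\<lambda>n. f k (int_decode n) z)" using sums[OF z] by (rule sums_summable)
    show "((\<lambda>w. f k (int_decode n) w) has_field_derivative \<i> * of_real pi * f (k + 2) (int_decode n) w) (at w within S)" for n w
      unfolding f_def
      by (rule DERIV_cong[OF DERIV_cmult[OF qpow_deriv]]) (simp add: power_add power2_eq_square)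
    define M where "M = (\<lambda>m::int. pi * (\<bar>of_int m + a\<bar> ^ (k + 2) * exp (- (pi * y * (of_int m + a)\<^sup>2))))"
    show "uniformly_convergent_on S (\<lambda>n w. \<Sum>i<n. \<i> * of_real pi * f (k + 2) (int_decode i) w)"
    proof (rule Weierstrass_m_test'[where M = "\<lambda>n. M (int_decode n)"])
      have "M summable_on UNIV"
        unfolding M_def using y by (intro summable_on_cmult_right gaussian_summable) auto
      then have "(\<lambda>n. M (int_decode n)) summable_on UNIV"
        by (subst summable_on_reindex_bij_betw[OF bij_int_decode])
      then show "summable (\<lambda>n. M (int_decode n))"
        by (rule summable_on_imp_summable)
      fix n w assume w: "w \<in> S"
      define x where "x = of_int (int_decode n) + a"
      have "norm (f (k + 2) (int_decode n) w)
          = norm (chi s (int_decode n)) * (\<bar>x\<bar> ^ (k + 2) * exp (- (pi * Im w * x\<^sup>2)))"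
        unfolding f_def x_def
        by (simp only: norm_mult norm_qpow norm_of_real power_abs mult.assoc)
      also have "\<dots> \<le> 1 * (\<bar>x\<bar> ^ (k + 2) * exp (- (pi * Im w * x\<^sup>2)))"
        using norm_chi_le[OF s] by (intro mult_right_mono) auto
      also have "\<dots> \<le> 1 * (\<bar>x\<bar> ^ (k + 2) * exp (- (pi * y * x\<^sup>2)))"
        using w by (intro mult_left_mono) (auto simp: S_def intro!: mult_right_mono)
      finally show "norm (\<i> * of_real pi * f (k + 2) (int_decode n) w) \<le> M (int_decode n)"
        by (simp add: norm_mult M_def x_def)
    qed
  qed (use zS in auto)
  also have "(\<Sum>n. \<i> * of_real pi * f (k + 2) (int_decode n) z) = \<i> * of_real pi * th a s (k + 2) z"
    using sums_mult[OF sums[OF z]] by (rule sums_unique[symmetric])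
  also have "((\<lambda>w. \<Sum>n. f k (int_decode n) w) has_field_derivative \<i> * of_real pi * th a s (k + 2) z) (at z)
     \<longleftrightarrow> (th a s k has_field_derivative \<i> * of_real pi * th a s (k + 2) z) (at z)"
  proof (rule DERIV_cong_ev)
    have "eventually (\<lambda>w. w \<in> {w. Im w > 0}) (nhds z)"
      using z by (intro eventually_nhds_in_open open_halfspace_Im_gt) auto
    then show "\<forall>\<^sub>F w in nhds z. (\<Sum>n. f k (int_decode n) w) = th a s k w"
      by eventually_elim (use sums in \<open>auto simp: sums_iff\<close>)
  qed auto
  finally show ?thesis .
qed

text \<open>As w m >= 1, passing from z to 2^N z shrinks the norm of every term by at least the
  factor exp (- pi Im z (2^N - 1)), which beats 4^N. The power 4^N is built in because of the factor
  in \<open>defect_duplication\<close>.\<close>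

lemma th_tail_tendsto:
  fixes w :: "int \<Rightarrow> real" and b :: "int \<Rightarrow> complex"
  assumes z: "Im z > 0" and X: "\<And>m. m \<in> X \<Longrightarrow> w m \<ge> 1"
    and sm: "(\<lambda>m. norm (b m * qpow z (w m))) summable_on X"
  shows "(\<lambda>N. 4 ^ N * (\<Sum>\<^sub>\<infinity>m\<in>X. b m * qpow (2 ^ N * z) (w m))) \<longlonglongrightarrow> 0"
proof (rule Lim_null_comparison)
  define C where "C = (\<Sum>\<^sub>\<infinity>m\<in>X. norm (b m * qpow z (w m)))"
  define p where "p = pi * Im z"
  have p: "p > 0" using z by (simp add: p_def)
  show "(\<lambda>N. 4 ^ N * (exp (- (p * (2 ^ N - 1))) * C)) \<longlonglongrightarrow> 0"
    using p by real_asymp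
  have "norm (\<Sum>\<^sub>\<infinity>m\<in>X. b m * qpow (2 ^ N * z) (w m)) \<le> exp (- (p * (2 ^ N - 1))) * C" for N
  proof (rule norm_infsum_le)
    show le: "norm (b m * qpow (2 ^ N * z) (w m)) \<le> exp (- (p * (2 ^ N - 1))) * norm (b m * qpow z (w m))" if "m \<in> X" for m
    proof -
      have "2 ^ N * z = of_real (2 ^ N) * z" by simp
      then have im: "Im (2 ^ N * z) = 2 ^ N * Im z"
        by (simp only: times_complex.sel Re_complex_of_real Im_complex_of_real)
      have "(p * (2 ^ N - 1)) * 1 \<le> (p * (2 ^ N - 1)) * w m"
        using p X[OF that] by (intro mult_left_mono) auto
      then have "exp (- (p * 2 ^ N * w m)) \<le> exp (- (p * (2 ^ N - 1))) * exp (- (p * w m))"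
        by (simp add: exp_add[symmetric] algebra_simps)
      then have "norm (b m) * exp (- (p * 2 ^ N * w m)) \<le> norm (b m) * (exp (- (p * (2 ^ N - 1))) * exp (- (p * w m)))"
        by (intro mult_left_mono) auto
      then show ?thesis
        by (simp add: norm_mult norm_qpow im p_def mult_ac)
    qed
    show "((\<lambda>m. b m * qpow (2 ^ N * z) (w m)) has_sum (\<Sum>\<^sub>\<infinity>m\<in>X. b m * qpow (2 ^ N * z) (w m))) X"
      by (rule has_sum_infsum, rule abs_summable_summable,
          rule Infinite_Sum.abs_summable_on_comparison_test'[OF summable_on_cmult_right[OF sm] le])
    show "((\<lambda>m. exp (- (p * (2 ^ N - 1))) * norm (b m * qpow z (w m))) has_sum (exp (- (p * (2 ^ N - 1))) * C)) X"
      unfolding C_def by (intro has_sum_cmult_right has_sum_infsum sm)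
  qed
  then show "\<forall>\<^sub>F N in sequentially. norm (4 ^ N * (\<Sum>\<^sub>\<infinity>m\<in>X. b m * qpow (2 ^ N * z) (w m))) \<le> 4 ^ N * (exp (- (p * (2 ^ N - 1))) * C)"
    by (intro always_eventually allI) (simp add: norm_mult norm_power)
qed

subsection \<open>Duplication\<close>

lemma has_sum_product_complex:
  fixes f :: "'a \<Rightarrow> complex" and g :: "'b \<Rightarrow> complex"
  assumes "(\<lambda>x. norm (f x)) summable_on A" "(\<lambda>y. norm (g y)) summable_on B"
  shows "((\<lambda>(x, y). f x * g y) has_sum infsum f A * infsum g B) (A \<times> B)"
proof -
  have "(\<lambda>p. norm ((\<lambda>(x, y). f x * g y) p)) summable_on A \<times> B"
  proof (subst Infinite_Sum.abs_summable_on_Sigma_iff, intro conjI ballI)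
    show "(\<lambda>y. norm (case (x, y) of (x, y) \<Rightarrow> f x * g y)) summable_on B" for x
      using summable_on_cmult_right[OF assms(2), of "norm (f x)"] by (simp add: norm_mult)
    have "(\<lambda>x. norm (f x) * (\<Sum>\<^sub>\<infinity>y\<in>B. norm (g y))) summable_on A"
      by (rule summable_on_cmult_left[OF assms(1)])
    moreover have "(\<Sum>\<^sub>\<infinity>y\<in>B. norm (g y)) \<ge> 0"
      by (rule infsum_nonneg) auto
    ultimately show "(\<lambda>x. norm (\<Sum>\<^sub>\<infinity>y\<in>B. norm (case (x, y) of (x, y) \<Rightarrow> f x * g y))) summable_on A"
      by (simp add: norm_mult infsum_cmult_right')
  qed
  then have s: "(\<lambda>(x, y). f x * g y) summable_on A \<times> B"
    by (rule abs_summable_summable)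
  have "infsum (\<lambda>(x, y). f x * g y) (A \<times> B) = infsum f A * infsum g B"
    by (subst infsum_Sigma'_banach[OF s, symmetric]) (simp add: infsum_cmult_right' infsum_cmult_left')
  with s show ?thesis by (metis has_sum_infsum)
qed

text \<open>The map (u, v) -> (u + v, u - v) hits exactly the pairs with even sum. The odd pairs
  need an offset: d = 1 amounts to shifting u and v by 1/2 on Z^2, and d = 0 to shifting v alone by
  1/2 on (Z + 1/2)^2.\<close>

lemma has_sum_parity_split:
  fixes f :: "int \<Rightarrow> int \<Rightarrow> complex"
  assumes e: "((\<lambda>(u, v). f (u + v) (u - v)) has_sum A) UNIV"
    and o: "((\<lambda>(u, v). f (u + v + d) (u - v + d - 1)) has_sum B) UNIV"
    and d: "d = 0 \<or> d = 1"
  shows "((\<lambda>(m, n). f m n) has_sum A + B) UNIV"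
proof -
  let ?E = "{(m, n). even (m + n :: int)}" and ?O = "{(m, n). odd (m + n :: int)}"
  have 1: "((\<lambda>(m, n). f m n) has_sum A) ?E"
    by (rule iffD1[OF has_sum_reindex_bij_witness[where S = UNIV and T = ?E and
          j = "\<lambda>(u, v). (u + v, u - v)" and i = "\<lambda>(m, n). ((m + n) div 2, (m - n) div 2)"] e])
       (auto elim!: evenE, presburger+)
  have 2: "((\<lambda>(m, n). f m n) has_sum B) ?O"
    by (rule iffD1[OF has_sum_reindex_bij_witness[where S = UNIV and T = ?O and
          j = "\<lambda>(u, v). (u + v + d, u - v + d - 1)" and
          i = "\<lambda>(m, n). ((m + n + 1) div 2 - d, (m - n - 1) div 2)"] o])
       (use d in \<open>auto\<close>, presburger+)
  have "?E \<union> ?O = UNIV" by auto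
  with has_sum_Un_disjoint[OF 1 2] show ?thesis by (simp add: disjoint_iff)
qed

text \<open>The weight P is an arbitrary function, so that the change of variables acts on it by
  plain substitution.\<close>

definition lat2 :: "real \<Rightarrow> real \<Rightarrow> complex \<Rightarrow> complex \<Rightarrow> (real \<Rightarrow> real \<Rightarrow> real) \<Rightarrow> complex \<Rightarrow> int \<Rightarrow> int \<Rightarrow> complex" where
  "lat2 a b s t P z m n = chi s m * chi t n * of_real (P (of_int m + a) (of_int n + b))
     * qpow z ((of_int m + a)\<^sup>2 + (of_int n + b)\<^sup>2)"

lemma lat2_monomial:
  assumes "norm s \<le> 1" "norm t \<le> 1" "Im z > 0"
  shows "((\<lambda>(m, n). lat2 a b s t (\<lambda>x y. x ^ k * y ^ l) z m n) has_sum th a s k z * th b t l z) UNIV"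
  using has_sum_product_complex[OF th_abs_summable[OF assms(1,3), of a k] th_abs_summable[OF assms(2,3), of b l]]
  unfolding th_def lat2_def by (simp add: qpow_add mult_ac)

text \<open>Listing P as triples of a coefficient and two exponents turns each application into a
  finite computation with products of \<open>th\<close>.\<close>

lemma lat2_poly:
  assumes "norm s \<le> 1" "norm t \<le> 1" "Im z > 0"
    and P: "\<And>x y. P x y = (\<Sum>(c, k, l)\<leftarrow>L. c * (x ^ k * y ^ l))"
  shows "((\<lambda>(m, n). lat2 a b s t P z m n) has_sum (\<Sum>(c, k, l)\<leftarrow>L. of_real c * (th a s k z * th b t l z))) UNIV"
  using P
proof (induction L arbitrary: P)
  case Nil
  then show ?case by (simp add: lat2_def case_prod_unfold)
next
  case (Cons q L)
  obtain c k l where q: "q = (c, k, l)" by (cases q) auto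
  have "((\<lambda>(m, n). lat2 a b s t (\<lambda>x y. \<Sum>(c, k, l)\<leftarrow>L. c * (x ^ k * y ^ l)) z m n) has_sum
      (\<Sum>(c, k, l)\<leftarrow>L. of_real c * (th a s k z * th b t l z))) UNIV"
    by (rule Cons.IH) simp
  from has_sum_add[OF has_sum_cmult_right[OF lat2_monomial[OF assms(1-3), of a b k l], of "of_real c"] this]
  show ?case
    by (simp add: Cons.prems q lat2_def case_prod_unfold algebra_simps)
qed

text \<open>The similarity doubles x^2 + y^2, which is the same as replacing z by 2 z; r records how
  the characters change.\<close>

lemma lat2_shift:
  assumes "of_int m + a = x + y" "of_int n + b = x - y" "x = of_int u + a'" "y = of_int v + b'"
    and "chi s m * chi t n = r * (chi s' u * chi t' v)"
  shows "lat2 a b s t P z m n = r * lat2 a' b' s' t' (\<lambda>x y. P (x + y) (x - y)) (2 * z) u v"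
proof -
  have "(x + y)\<^sup>2 + (x - y)\<^sup>2 = 2 * (x\<^sup>2 + y\<^sup>2)"
    by (simp add: power2_eq_square algebra_simps)
  then show ?thesis
    using assms(5) unfolding lat2_def assms(1,2)
    by (simp add: qpow_double assms(3,4))
qed

lemma chi_square: "\<sigma>\<^sup>2 = 1 \<Longrightarrow> chi \<sigma> m * chi \<sigma> n = (if even (m + n) then 1 else \<sigma>)"
  by (auto simp: chi_def power2_eq_square)

text \<open>The two characters multiply to sigma^(m + n), which is constant on each parity class.
  Hence trivial characters remain at 2 z, and sigma only weighs the odd class.\<close>

lemma lat2_rotate_integer:
  assumes \<sigma>: "\<sigma>\<^sup>2 = 1"
    and e: "((\<lambda>(u, v). lat2 0 0 1 1 (\<lambda>x y. P (x + y) (x - y)) (2 * z) u v) has_sum A) UNIV"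
    and o: "((\<lambda>(u, v). lat2 (1/2) (1/2) 1 1 (\<lambda>x y. P (x + y) (x - y)) (2 * z) u v) has_sum B) UNIV"
  shows "((\<lambda>(m, n). lat2 0 0 \<sigma> \<sigma> P z m n) has_sum A + \<sigma> * B) UNIV"
proof (rule has_sum_parity_split[where d = 1])
  have "lat2 0 0 \<sigma> \<sigma> P z (u + v) (u - v) = 1 * lat2 0 0 1 1 (\<lambda>x y. P (x + y) (x - y)) (2 * z) u v" for u v
    by (rule lat2_shift) (auto simp: chi_square[OF \<sigma>], auto simp: chi_def)
  with e show "((\<lambda>(u, v). lat2 0 0 \<sigma> \<sigma> P z (u + v) (u - v)) has_sum A) UNIV" by simp
  have "lat2 0 0 \<sigma> \<sigma> P z (u + v + 1) (u - v + 1 - 1)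
      = \<sigma> * lat2 (1/2) (1/2) 1 1 (\<lambda>x y. P (x + y) (x - y)) (2 * z) u v" for u v
    by (rule lat2_shift[where x = "of_int u + 1/2" and y = "of_int v + 1/2"])
       (auto simp: chi_square[OF \<sigma>], auto simp: chi_def)
  with has_sum_cmult_right[OF o, of \<sigma>]
  show "((\<lambda>(u, v). lat2 0 0 \<sigma> \<sigma> P z (u + v + 1) (u - v + 1 - 1)) has_sum \<sigma> * B) UNIV"
    by (simp add: case_prod_unfold)
qed simp

lemma lat2_rotate_half_integer:
  assumes \<sigma>: "\<sigma>\<^sup>2 = 1"
    and e: "((\<lambda>(u, v). lat2 (1/2) 0 1 1 (\<lambda>x y. P (x + y) (x - y)) (2 * z) u v) has_sum A) UNIV"
    and o: "((\<lambda>(u, v). lat2 0 (1/2) 1 1 (\<lambda>x y. P (x + y) (x - y)) (2 * z) u v) has_sum B) UNIV"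
  shows "((\<lambda>(m, n). lat2 (1/2) (1/2) \<sigma> \<sigma> P z m n) has_sum A + \<sigma> * B) UNIV"
proof (rule has_sum_parity_split[where d = 0])
  have "lat2 (1/2) (1/2) \<sigma> \<sigma> P z (u + v) (u - v) = 1 * lat2 (1/2) 0 1 1 (\<lambda>x y. P (x + y) (x - y)) (2 * z) u v" for u v
    by (rule lat2_shift[where x = "of_int u + 1/2" and y = "of_int v"])
       (auto simp: chi_square[OF \<sigma>], auto simp: chi_def)
  with e show "((\<lambda>(u, v). lat2 (1/2) (1/2) \<sigma> \<sigma> P z (u + v) (u - v)) has_sum A) UNIV" by simp
  have "lat2 (1/2) (1/2) \<sigma> \<sigma> P z (u + v + 0) (u - v + 0 - 1)
      = \<sigma> * lat2 0 (1/2) 1 1 (\<lambda>x y. P (x + y) (x - y)) (2 * z) u v" for u v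
    by (rule lat2_shift[where x = "of_int u" and y = "of_int v + 1/2"])
       (auto simp: chi_square[OF \<sigma>], auto simp: chi_def)
  with has_sum_cmult_right[OF o, of \<sigma>]
  show "((\<lambda>(u, v). lat2 (1/2) (1/2) \<sigma> \<sigma> P z (u + v + 0) (u - v + 0 - 1)) has_sum \<sigma> * B) UNIV"
    by (simp add: case_prod_unfold)
qed simp

text \<open>Here n = u - v on both classes, and (-1)^n = (-1)^u (-1)^v makes both characters at 2 z
  alternating.\<close>

lemma lat2_rotate_mixed:
  assumes e: "((\<lambda>(u, v). lat2 0 0 (-1) (-1) (\<lambda>x y. P (x + y) (x - y)) (2 * z) u v) has_sum A) UNIV"
    and o: "((\<lambda>(u, v). lat2 (1/2) (1/2) (-1) (-1) (\<lambda>x y. P (x + y) (x - y)) (2 * z) u v) has_sum B) UNIV"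
  shows "((\<lambda>(m, n). lat2 0 0 1 (-1) P z m n) has_sum A + B) UNIV"
proof (rule has_sum_parity_split[where d = 1])
  have "lat2 0 0 1 (-1) P z (u + v) (u - v) = 1 * lat2 0 0 (-1) (-1) (\<lambda>x y. P (x + y) (x - y)) (2 * z) u v" for u v
    by (rule lat2_shift) (auto simp: chi_def)
  with e show "((\<lambda>(u, v). lat2 0 0 1 (-1) P z (u + v) (u - v)) has_sum A) UNIV" by simp
  have "lat2 0 0 1 (-1) P z (u + v + 1) (u - v + 1 - 1)
      = 1 * lat2 (1/2) (1/2) (-1) (-1) (\<lambda>x y. P (x + y) (x - y)) (2 * z) u v" for u v
    by (rule lat2_shift[where x = "of_int u + 1/2" and y = "of_int v + 1/2"]) (auto simp: chi_def)
  with o show "((\<lambda>(u, v). lat2 0 0 1 (-1) P z (u + v + 1) (u - v + 1 - 1)) has_sum B) UNIV"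
    by simp
qed simp

section \<open>Parity and the duplication formulas\<close>

lemma th_odd:
  assumes "norm s \<le> 1" "Im z > 0" "odd k"
  shows "th 0 s k z = 0"
proof -
  have "((\<lambda>m::int. chi s m * of_real ((of_int m + 0) ^ k) * qpow z ((of_int m + 0)\<^sup>2)) has_sum - th 0 s k z) UNIV"
    by (rule iffD1[OF has_sum_reindex_bij_witness[where S = UNIV and i = uminus and j = uminus] has_sum_uminusI[OF th_has_sum[OF assms(1,2), of 0 k]]])
       (use assms in \<open>auto simp: chi_def power_minus_odd\<close>)
  from has_sum_unique[OF this th_has_sum[OF assms(1,2), of 0 k]] show ?thesis by simp
qed

text \<open>The reflection m -> -1 - m changes the sign of m + 1/2 and the parity of m, so terms
  with an even weight cancel in pairs.\<close>

lemma th_half_alternating_even: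
  assumes "Im z > 0" "even k"
  shows "th (1/2) (-1) k z = 0"
proof -
  have n: "norm (-1 :: complex) \<le> 1" by simp
  have x: "(of_int (- 1 - m) + 1/2 :: real) = - (of_int m + 1/2)" for m by simp
  have eq: "chi (-1) (-1 - m) * of_real ((of_int (-1 - m) + 1/2) ^ k) * qpow z ((of_int (-1 - m) + 1/2)\<^sup>2)
      = - (chi (-1) m * of_real ((of_int m + 1/2) ^ k) * qpow z ((of_int m + 1/2)\<^sup>2))" for m
    unfolding x power_minus_even[OF assms(2)] power2_minus by (simp add: chi_def)
  have "((\<lambda>m::int. chi (-1) m * of_real ((of_int m + 1/2) ^ k) * qpow z ((of_int m + 1/2)\<^sup>2)) has_sum - th (1/2) (-1) k z) UNIV"
    by (rule iffD1[OF has_sum_reindex_bij_witness[where S = UNIV and i = "\<lambda>m. -1 - m" and j = "\<lambda>m. -1 - m"] has_sum_uminusI[OF th_has_sum[OF n assms(1), of "1/2" k]]])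
       (simp_all only: eq, simp_all)
  from has_sum_unique[OF this th_has_sum[OF n assms(1), of "1/2" k]] show ?thesis by simp
qed

text \<open>The weights are 1, (x^2 + y^2) / 2 and x^4 - 6 x^2 y^2 + y^4 = Re (x + i y)^4. Because
  (x + y) + i (x - y) = (1 + i) (x - i y) and (1 + i)^4 = -4, the last weight returns multiplied by
  -4.\<close>

lemma th_integer_duplication:
  assumes z: "Im z > 0" and \<sigma>: "\<sigma>\<^sup>2 = 1"
  shows "(th 0 \<sigma> 0 z)\<^sup>2 = (th 0 1 0 (2 * z))\<^sup>2 + \<sigma> * (th (1/2) 1 0 (2 * z))\<^sup>2" (is ?A)
    and "th 0 \<sigma> 0 z * th 0 \<sigma> 2 z
      = 2 * (th 0 1 0 (2 * z) * th 0 1 2 (2 * z) + \<sigma> * (th (1/2) 1 0 (2 * z) * th (1/2) 1 2 (2 * z)))" (is ?B)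
    and "th 0 \<sigma> 0 z * th 0 \<sigma> 4 z - 3 * (th 0 \<sigma> 2 z)\<^sup>2
      = - 4 * ((th 0 1 0 (2 * z) * th 0 1 4 (2 * z) - 3 * (th 0 1 2 (2 * z))\<^sup>2)
          + \<sigma> * (th (1/2) 1 0 (2 * z) * th (1/2) 1 4 (2 * z) - 3 * (th (1/2) 1 2 (2 * z))\<^sup>2))" (is ?C)
proof -
  have n: "norm \<sigma> \<le> 1" "norm (1 :: complex) \<le> 1" "Im (2 * z) > 0"
    using \<sigma> z by (auto simp: power2_eq_1_iff)
  note sum = has_sum_unique[OF lat2_poly[OF n(1,1) z] lat2_rotate_integer[OF \<sigma> lat2_poly[OF n(2,2,3)] lat2_poly[OF n(2,2,3)]]]
  show ?A
    using sum[of "\<lambda>x y. 1" "[(1,0,0)]" "[(1,0,0)]" "[(1,0,0)]"]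
    by (simp add: power2_eq_square)
  show ?B
    using sum[of "\<lambda>x y. (x^2 + y^2) / 2" "[(1/2,2,0),(1/2,0,2)]" "[(1,2,0),(1,0,2)]" "[(1,2,0),(1,0,2)]"]
    by (simp add: power2_eq_square algebra_simps)
  have "2 * (th 0 \<sigma> 0 z * th 0 \<sigma> 4 z - 3 * (th 0 \<sigma> 2 z)\<^sup>2)
      = 2 * (- 4 * ((th 0 1 0 (2 * z) * th 0 1 4 (2 * z) - 3 * (th 0 1 2 (2 * z))\<^sup>2)
          + \<sigma> * (th (1/2) 1 0 (2 * z) * th (1/2) 1 4 (2 * z) - 3 * (th (1/2) 1 2 (2 * z))\<^sup>2)))"
    using sum[of "\<lambda>x y. x^4 - 6 * x^2 * y^2 + y^4" "[(1,4,0),(-6,2,2),(1,0,4)]"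
        "[(-4,4,0),(24,2,2),(-4,0,4)]" "[(-4,4,0),(24,2,2),(-4,0,4)]"]
    by (simp add: power2_eq_square power4_eq_xxxx algebra_simps)
  then show ?C by (simp only: mult_cancel_left) simp
qed

text \<open>The alternating half-integral series vanish for even weights, so the third formula takes
  the weight x y, which becomes x^2 - y^2.\<close>

lemma th_half_integer_duplication:
  assumes z: "Im z > 0"
  shows "(th (1/2) 1 0 z)\<^sup>2 = 2 * th 0 1 0 (2 * z) * th (1/2) 1 0 (2 * z)" (is ?A)
    and "th (1/2) 1 0 z * th (1/2) 1 2 z
      = 2 * (th 0 1 0 (2 * z) * th (1/2) 1 2 (2 * z) + th 0 1 2 (2 * z) * th (1/2) 1 0 (2 * z))" (is ?B)
    and "(th (1/2) (-1) 1 z)\<^sup>2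
      = 2 * (th 0 1 0 (2 * z) * th (1/2) 1 2 (2 * z) - th 0 1 2 (2 * z) * th (1/2) 1 0 (2 * z))" (is ?C)
proof -
  have n: "norm (- 1 :: complex) \<le> 1" "norm (1 :: complex) \<le> 1" "Im (2 * z) > 0"
    using z by auto
  have \<sigma>: "1\<^sup>2 = (1::complex)" "(-1)\<^sup>2 = (1::complex)" by auto
  note sum = has_sum_unique[OF lat2_poly[OF n(2,2) z] lat2_rotate_half_integer[OF \<sigma>(1) lat2_poly[OF n(2,2,3)] lat2_poly[OF n(2,2,3)]]]
  note sum' = has_sum_unique[OF lat2_poly[OF n(1,1) z] lat2_rotate_half_integer[OF \<sigma>(2) lat2_poly[OF n(2,2,3)] lat2_poly[OF n(2,2,3)]]]
  show ?A
    using sum[of "\<lambda>x y. 1" "[(1,0,0)]" "[(1,0,0)]" "[(1,0,0)]"]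
    by (simp add: power2_eq_square)
  show ?B
    using sum[of "\<lambda>x y. (x^2 + y^2) / 2" "[(1/2,2,0),(1/2,0,2)]" "[(1,2,0),(1,0,2)]" "[(1,2,0),(1,0,2)]"]
    by (simp add: power2_eq_square algebra_simps)
  show ?C
    using sum'[of "\<lambda>x y. x * y" "[(1,1,1)]" "[(1,2,0),(-1,0,2)]" "[(1,2,0),(-1,0,2)]"]
    by (simp add: power2_eq_square algebra_simps)
qed

text \<open>In each formula one parity class drops out: the half-integral one for the weight 1, the
  integral one for the weight x^2 - y^2, which becomes 4 x y.\<close>

lemma th_mixed_duplication:
  assumes z: "Im z > 0"
  shows "th 0 1 0 z * th 0 (-1) 0 z = (th 0 (-1) 0 (2 * z))\<^sup>2" (is ?A)
    and "th 0 (-1) 0 z * th 0 1 2 z - th 0 1 0 z * th 0 (-1) 2 z = 4 * (th (1/2) (-1) 1 (2 * z))\<^sup>2" (is ?B)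
proof -
  have n: "norm (- 1 :: complex) \<le> 1" "norm (1 :: complex) \<le> 1" "Im (2 * z) > 0"
    using z by auto
  note sum = has_sum_unique[OF lat2_poly[OF n(2,1) z] lat2_rotate_mixed[OF lat2_poly[OF n(1,1,3)] lat2_poly[OF n(1,1,3)]]]
  show ?A
    using sum[of "\<lambda>x y. 1" "[(1,0,0)]" "[(1,0,0)]" "[(1,0,0)]"] th_half_alternating_even[OF n(3), of 0]
    by (simp add: power2_eq_square)
  show ?B
    using sum[of "\<lambda>x y. x^2 - y^2" "[(1,2,0),(-1,0,2)]" "[(4,1,1)]" "[(4,1,1)]"] th_odd[OF n(1,3), of 1]
    by (simp add: power2_eq_square algebra_simps)
qed

subsection \<open>The differential equations of the theta constants\<close>

lemma Im_pow2_mult: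
  assumes "Im z > 0"
  shows "Im (2 ^ N * z) > 0"
proof -
  have "2 ^ N * z = of_real (2 ^ N) * z" by simp
  then have "Im (2 ^ N * z) = 2 ^ N * Im z"
    by (simp only: times_complex.sel Re_complex_of_real Im_complex_of_real)
  then show ?thesis using assms by simp
qed

text \<open>Division by q^r removes the leading power; the terms outside F then have exponent at
  least 1 and fall under \<open>th_tail_tendsto\<close>.\<close>

lemma th_leading_terms:
  assumes s: "norm s \<le> 1" and z: "Im z > 0" and F: "finite F"
    and r: "\<And>m. m \<notin> F \<Longrightarrow> (of_int m + a)\<^sup>2 \<ge> r + 1"
  shows "(\<lambda>N. 4 ^ N * (th a s k (2 ^ N * z) / qpow (2 ^ N * z) r
     - (\<Sum>m\<in>F. chi s m * of_real ((of_int m + a) ^ k) * qpow (2 ^ N * z) ((of_int m + a)\<^sup>2 - r)))) \<longlonglongrightarrow> 0"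
proof -
  define b where "b m = chi s m * of_real ((of_int m + a) ^ k)" for m
  define w where "w m = (of_int m + a)\<^sup>2 - r" for m :: int
  have trm: "chi s m * of_real ((of_int m + a) ^ k) * qpow y ((of_int m + a)\<^sup>2) = b m * qpow y (w m) * qpow y r" for y m
  proof -
    have "(of_int m + a)\<^sup>2 = w m + r" by (simp add: w_def)
    then show ?thesis by (simp add: b_def qpow_add)
  qed
  have split: "th a s k y / qpow y r - (\<Sum>m\<in>F. b m * qpow y (w m)) = (\<Sum>\<^sub>\<infinity>m\<in>-F. b m * qpow y (w m))" if "Im y > 0" for y
  proof -
    have "((\<lambda>m. b m * qpow y (w m) * qpow y r * inverse (qpow y r)) has_sum th a s k y * inverse (qpow y r)) UNIV"
      using has_sum_cmult_left[OF th_has_sum[OF s that, of a k], of "inverse (qpow y r)"] by (simp only: trm)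
    then have 1: "((\<lambda>m. b m * qpow y (w m)) has_sum th a s k y / qpow y r) UNIV"
      by (simp add: mult.assoc divide_inverse)
    have 2: "((\<lambda>m. b m * qpow y (w m)) has_sum (\<Sum>m\<in>F. b m * qpow y (w m))) F"
      using F by (rule has_sum_finite)
    from has_sum_Diff[OF 1 2] have "((\<lambda>m. b m * qpow y (w m)) has_sum (th a s k y / qpow y r - (\<Sum>m\<in>F. b m * qpow y (w m)))) (-F)"
      by (simp add: Compl_eq_Diff_UNIV)
    then show ?thesis by (rule infsumI[symmetric])
  qed
  have "(\<lambda>N. 4 ^ N * (\<Sum>\<^sub>\<infinity>m\<in>-F. b m * qpow (2 ^ N * z) (w m))) \<longlonglongrightarrow> 0"
  proof (rule th_tail_tendsto[OF z])
    show "w m \<ge> 1" if "m \<in> -F" for m using r[of m] that by (auto simp: w_def)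
    have "(\<lambda>m. norm (b m * qpow z (w m) * qpow z r)) summable_on UNIV"
      using th_abs_summable[OF s z, of a k] by (simp only: trm)
    then have "(\<lambda>m. norm (b m * qpow z (w m) * qpow z r)) summable_on -F"
      by (rule summable_on_subset_banach) simp
    from summable_on_cmult_left[OF this, of "inverse (norm (qpow z r))"]
    show "(\<lambda>m. norm (b m * qpow z (w m))) summable_on -F"
      by (simp add: norm_mult mult.assoc)
  qed
  then show ?thesis
    unfolding split[OF Im_pow2_mult[OF z], symmetric] by (simp only: b_def w_def)
qed

lemma tendsto_of_scaled_zero:
  fixes f :: "nat \<Rightarrow> complex"
  assumes "(\<lambda>N. 4 ^ N * (f N - c)) \<longlonglongrightarrow> 0"
  shows "f \<longlonglongrightarrow> c"
proof -
  have "(\<lambda>N. (1/4) ^ N * (4 ^ N * (f N - c))) \<longlonglongrightarrow> 0 * 0"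
    by (intro tendsto_mult assms LIMSEQ_power_zero) (simp add: norm_divide)
  then have "(\<lambda>N. f N - c) \<longlonglongrightarrow> 0"
    by (simp add: power_divide)
  then show ?thesis by (rule LIM_zero_cancel)
qed

lemma th_integer_scaled_limit:
  assumes "norm s \<le> 1" "Im z > 0"
  shows "(\<lambda>N. 4 ^ N * (th 0 s k (2 ^ N * z) - (if k = 0 then 1 else 0))) \<longlonglongrightarrow> 0"
proof -
  have "1 \<le> (of_int m :: real)\<^sup>2" if "m \<noteq> 0" for m :: int
  proof -
    have "1 \<le> \<bar>m\<bar>" using that by linarith
    then have "1 \<le> \<bar>of_int m :: real\<bar>" by linarith
    then show ?thesis using abs_le_square_iff[of 1 "of_int m :: real"] by simp
  qed
  then have "0 + 1 \<le> (of_int m + 0 :: real)\<^sup>2" if "m \<notin> {0}" for m :: int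
    using that by simp
  from th_leading_terms[where F = "{0}", OF assms _ this, where k = k]
  show ?thesis
    by (cases "k = 0") (simp_all add: qpow_def chi_def power_0_left)
qed

text \<open>The leading exponent 1/4 is attained at m = 0 and m = -1, which contribute (1/2)^k and s
  (-1/2)^k; all other exponents are at least 9/4.\<close>

lemma th_half_integer_scaled_limit:
  assumes "norm s \<le> 1" "Im z > 0"
  shows "(\<lambda>N. 4 ^ N * (th (1/2) s k (2 ^ N * z) / qpow (2 ^ N * z) (1/4) - ((1/2) ^ k + s * (-1/2) ^ k))) \<longlonglongrightarrow> 0"
proof -
  have "1/4 + 1 \<le> (of_int m + 1/2 :: real)\<^sup>2" if "m \<notin> {0, -1}" for m :: int
  proof -
    have "m \<ge> 1 \<or> m \<le> -2" using that by auto
    then have "2 \<le> m * (m + 1)"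
    proof
      assume "m \<ge> 1" then show ?thesis using mult_mono[of 1 m 2 "m + 1"] by simp
    next
      assume "m \<le> -2" then show ?thesis using mult_mono[of 1 "-(m + 1)" 2 "-m"] by (simp add: algebra_simps)
    qed
    then have "2 \<le> of_int (m * (m + 1) :: int) + (0 :: real)" by linarith
    then show ?thesis by (simp add: power2_eq_square algebra_simps)
  qed
  from th_leading_terms[where F = "{0, -1}", OF assms _ this, where k = k]
  show ?thesis
    by (simp add: qpow_def chi_def power2_eq_square)
qed

text \<open>\<open>th3 (2 * k)\<close> is the \<open>k\<close>-fold \<open>q d/dq\<close>-derivative of \<open>\<theta>\<^sub>3\<close>, and similarly for \<open>th2\<close> and \<open>th4\<close>;
  \<open>th1\<close> corresponds to \<open>\<theta>\<^sub>1'(0)\<close>, up to a constant factor.\<close>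
abbreviation "th3 \<equiv> th 0 1"
abbreviation "th4 \<equiv> th 0 (-1)"
abbreviation "th2 \<equiv> th (1/2) 1"
abbreviation "th1 \<equiv> th (1/2) (-1) 1"

lemma th_limits:
  assumes z: "Im z > 0"
  shows "(\<lambda>N. th3 0 (2 ^ N * z)) \<longlonglongrightarrow> 1" "(\<lambda>N. th4 0 (2 ^ N * z)) \<longlonglongrightarrow> 1"
    "(\<lambda>N. th2 0 (2 ^ N * z) / qpow (2 ^ N * z) (1/4)) \<longlonglongrightarrow> 2"
    "(\<lambda>N. th1 (2 ^ N * z) / qpow (2 ^ N * z) (1/4)) \<longlonglongrightarrow> 1"
proof -
  have n: "norm (- 1 :: complex) \<le> 1" "norm (1 :: complex) \<le> 1" by auto
  show "(\<lambda>N. th3 0 (2 ^ N * z)) \<longlonglongrightarrow> 1" "(\<lambda>N. th4 0 (2 ^ N * z)) \<longlonglongrightarrow> 1"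
    by (rule tendsto_of_scaled_zero, use th_integer_scaled_limit[OF n(2) z, of 0] in simp)
       (rule tendsto_of_scaled_zero, use th_integer_scaled_limit[OF n(1) z, of 0] in simp)
  show "(\<lambda>N. th2 0 (2 ^ N * z) / qpow (2 ^ N * z) (1/4)) \<longlonglongrightarrow> 2"
    by (rule tendsto_of_scaled_zero) (use th_half_integer_scaled_limit[OF n(2) z, of 0] in simp)
  show "(\<lambda>N. th1 (2 ^ N * z) / qpow (2 ^ N * z) (1/4)) \<longlonglongrightarrow> 1"
    by (rule tendsto_of_scaled_zero) (use th_half_integer_scaled_limit[OF n(1) z, of 1] in simp)
qed

text \<open>The duplication formulas carry nonvanishing from \<open>2 z\<close> down to \<open>z\<close>, and near \<open>i \<infinity>\<close> it is clear.\<close>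
lemma theta_nonzero:
  assumes "Im z > 0"
  shows "th3 0 z \<noteq> 0" "th4 0 z \<noteq> 0" "th2 0 z \<noteq> 0"
proof -
  let ?P = "\<lambda>z. th3 0 z \<noteq> 0 \<and> th4 0 z \<noteq> 0 \<and> th2 0 z \<noteq> 0"
  have step: "?P z" if "Im z > 0" "?P (2 * z)" for z
    using th_mixed_duplication(1)[OF that(1)] th_half_integer_duplication(1)[OF that(1)] that(2) by auto
  have desc: "?P (2 ^ N * z) \<Longrightarrow> ?P z" if "Im z > 0" for N z
    using that
  proof (induction N arbitrary: z)
    case (Suc N)
    have "?P (2 ^ N * (2 * z))" using Suc.prems(1) by (simp add: mult_ac)
    then have "?P (2 * z)" using Suc.IH[of "2 * z"] Suc.prems(2) by simp
    then show ?case using step[OF Suc.prems(2)] by simp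
  qed simp
  have nz: "\<forall>\<^sub>F N in sequentially. f N \<noteq> 0" if "f \<longlonglongrightarrow> c" "c \<noteq> 0" for f :: "nat \<Rightarrow> complex" and c
    using that by (rule tendsto_imp_eventually_ne)
  have "\<forall>\<^sub>F N in sequentially. ?P (2 ^ N * z)"
    using nz[OF th_limits(1)[OF assms]] nz[OF th_limits(2)[OF assms]] nz[OF th_limits(3)[OF assms]]
    by (simp add: eventually_conj_iff)
  then obtain N where "?P (2 ^ N * z)" using eventually_happens by fastforce
  from desc[OF assms this] show "th3 0 z \<noteq> 0" "th4 0 z \<noteq> 0" "th2 0 z \<noteq> 0" by auto
qed

section \<open>Algebraic relations and Jacobi's derivative formula\<close>

lemma theta_quartic:
  assumes z: "Im z > 0"
  shows "th3 0 z ^ 4 = th4 0 z ^ 4 + th2 0 z ^ 4"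
proof -
  have sq: "(x :: complex) ^ 4 = (x\<^sup>2)\<^sup>2" for x by simp
  show ?thesis
    \<comment> \<open>With S = theta_3 (2 z) and T = theta_2 (2 z) the claim becomes (S^2 + T^2)^2 =
      (S^2 - T^2)^2 + (2 S T)^2.\<close>
    unfolding sq th_integer_duplication(1)[OF z power_one] th_half_integer_duplication(1)[OF z]
      th_integer_duplication(1)[OF z power2_minus[of 1, unfolded power_one]]
    by (simp add: power2_eq_square algebra_simps)
qed

text \<open>The duplication formulas turn both claims into polynomial identities in values at 2 z.
  The second is what differentiating \<open>theta_quartic\<close> would give.\<close>

lemma theta_quadratic_relations:
  assumes z: "Im z > 0"
  shows "(th1 z)\<^sup>2 * (th2 0 z)\<^sup>2 = th3 0 z * th4 0 z * (th4 0 z * th3 2 z - th3 0 z * th4 2 z)"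
    and "th2 0 z ^ 3 * th2 2 z = th3 0 z ^ 3 * th3 2 z - th4 0 z ^ 3 * th4 2 z"
proof -
  note h = th_integer_duplication(1,2)[OF z power_one] th_half_integer_duplication[OF z]
    th_integer_duplication(1,2)[OF z power2_minus[of 1, unfolded power_one]]
  have "th3 0 z * th4 0 z * (th4 0 z * th3 2 z - th3 0 z * th4 2 z)
      = (th4 0 z)\<^sup>2 * (th3 0 z * th3 2 z) - (th3 0 z)\<^sup>2 * (th4 0 z * th4 2 z)"
    by (simp add: power2_eq_square algebra_simps)
  also have "\<dots> = (th1 z)\<^sup>2 * (th2 0 z)\<^sup>2"
    unfolding h by (simp add: power2_eq_square algebra_simps)
  finally show "(th1 z)\<^sup>2 * (th2 0 z)\<^sup>2 = th3 0 z * th4 0 z * (th4 0 z * th3 2 z - th3 0 z * th4 2 z)" ..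
  have cube: "x ^ 3 * y = x\<^sup>2 * (x * y)" for x y :: complex
    by (simp add: power2_eq_square power3_eq_cube)
  show "th2 0 z ^ 3 * th2 2 z = th3 0 z ^ 3 * th3 2 z - th4 0 z ^ 3 * th4 2 z"
    unfolding cube h by (simp add: power2_eq_square algebra_simps)
qed

text \<open>Iteration gives r z = c^N r (2^N z) for every N, so the limit along this one sequence
  determines r z.\<close>

lemma constant_from_duplication:
  fixes r :: "complex \<Rightarrow> complex"
  assumes "\<And>z. Im z > 0 \<Longrightarrow> r z = c * r (2 * z)" "Im z > 0" "(\<lambda>N. c ^ N * r (2 ^ N * z)) \<longlonglongrightarrow> l"
  shows "r z = l"
proof -
  have "c ^ N * r (2 ^ N * z) = r z" for N
  proof (induction N)
    case (Suc N)
    have "r (2 ^ N * z) = c * r (2 * (2 ^ N * z))"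
      by (rule assms(1)) (rule Im_pow2_mult[OF assms(2)])
    then show ?case using Suc.IH by (simp add: mult_ac)
  qed simp
  with assms(3) show ?thesis by (simp add: LIMSEQ_const_iff)
qed

lemma jacobi_derivative_formula_squared:
  assumes z: "Im z > 0"
  shows "4 * (th1 z)\<^sup>2 = (th2 0 z * th3 0 z * th4 0 z)\<^sup>2"
proof -
  define r where "r z = 4 * (th1 z)\<^sup>2 / (th2 0 z * th3 0 z * th4 0 z)\<^sup>2" for z
  have "r z = 1"
  proof (rule constant_from_duplication[where c = 1, OF _ z])
    show "r z = 1 * r (2 * z)" if z: "Im z > 0" for z
    proof -
      \<comment> \<open>The bracket in the first quadratic relation is
        \<open>4 * (th1 (2 * z))\<^sup>2\<close> by the mixed duplication formula; this links
        \<open>th1\<close> at z and at 2 z.\<close>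
      have 1: "4 * (th1 (2 * z))\<^sup>2 * (th3 0 z * th4 0 z) = (th1 z)\<^sup>2 * (th2 0 z)\<^sup>2"
        using th_mixed_duplication(2)[OF z] theta_quadratic_relations(1)[OF z] by (simp add: mult_ac)
      have 2: "4 * (th2 0 (2 * z) * th3 0 (2 * z) * th4 0 (2 * z))\<^sup>2 = th2 0 z ^ 4 * (th3 0 z * th4 0 z)"
      proof -
        have "4 * (th2 0 (2 * z) * th3 0 (2 * z) * th4 0 (2 * z))\<^sup>2
            = (2 * th3 0 (2 * z) * th2 0 (2 * z))\<^sup>2 * (th4 0 (2 * z))\<^sup>2"
          by (simp add: power_mult_distrib mult_ac)
        then show ?thesis
          by (simp flip: th_half_integer_duplication(1)[OF z] th_mixed_duplication(1)[OF z])
      qed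
      have "4 * ((th1 z)\<^sup>2 * (th2 0 (2 * z) * th3 0 (2 * z) * th4 0 (2 * z))\<^sup>2)
          = (th1 z)\<^sup>2 * (th2 0 z)\<^sup>2 * (th2 0 z)\<^sup>2 * (th3 0 z * th4 0 z)"
        using arg_cong[OF 2, of "\<lambda>x. (th1 z)\<^sup>2 * x"]
        by (simp add: power2_eq_square power4_eq_xxxx mult_ac)
      also have "\<dots> = 4 * ((th1 (2 * z))\<^sup>2 * (th2 0 z * th3 0 z * th4 0 z)\<^sup>2)"
        unfolding 1[symmetric] by (simp add: power2_eq_square mult_ac)
      finally show ?thesis
        using theta_nonzero[OF z] theta_nonzero[of "2 * z"] z
        unfolding r_def by (simp add: frac_eq_eq mult_ac)
    qed
    \<comment> \<open>Numerator and denominator of r both carry the leading power q^(1/2); once it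
      is cancelled, the limit is 4 / 2^2 = 1.\<close>
    have "r (2 ^ N * z) = 4 * (th1 (2 ^ N * z) / qpow (2 ^ N * z) (1/4))\<^sup>2
        / ((th2 0 (2 ^ N * z) / qpow (2 ^ N * z) (1/4)) * th3 0 (2 ^ N * z) * th4 0 (2 ^ N * z))\<^sup>2" for N
      by (simp add: r_def power_divide power_mult_distrib)
    moreover have "(\<lambda>N. 4 * (th1 (2 ^ N * z) / qpow (2 ^ N * z) (1/4))\<^sup>2
        / ((th2 0 (2 ^ N * z) / qpow (2 ^ N * z) (1/4)) * th3 0 (2 ^ N * z) * th4 0 (2 ^ N * z))\<^sup>2) \<longlonglongrightarrow> 4 * 1\<^sup>2 / (2 * 1 * 1)\<^sup>2"
      by (intro tendsto_intros th_limits[OF z]) auto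
    ultimately show "(\<lambda>N. 1 ^ N * r (2 ^ N * z)) \<longlonglongrightarrow> 1" by simp
  qed
  then show ?thesis using theta_nonzero[OF z] by (simp add: r_def divide_simps split: if_splits)
qed

text \<open>Jacobi's formula eliminates \<open>th1\<close> from the first quadratic relation, and
  the common factor theta_3 theta_4 cancels.\<close>

lemma theta_wronskian_34:
  assumes z: "Im z > 0"
  shows "4 * (th4 0 z * th3 2 z - th3 0 z * th4 2 z) = th2 0 z ^ 4 * th3 0 z * th4 0 z"
proof -
  have "(th3 0 z * th4 0 z) * (4 * (th4 0 z * th3 2 z - th3 0 z * th4 2 z)) = 4 * (th1 z)\<^sup>2 * (th2 0 z)\<^sup>2"
    using theta_quadratic_relations(1)[OF z] by (simp add: mult_ac)
  also have "\<dots> = (th3 0 z * th4 0 z) * (th2 0 z ^ 4 * th3 0 z * th4 0 z)"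
    unfolding jacobi_derivative_formula_squared[OF z] by (simp add: power2_eq_square power4_eq_xxxx mult_ac)
  finally show ?thesis using theta_nonzero[OF z] unfolding mult_cancel_left by simp
qed

lemma theta_wronskian_23:
  assumes z: "Im z > 0"
  shows "4 * (th3 0 z * th2 2 z - th2 0 z * th3 2 z) = th4 0 z ^ 4 * th2 0 z * th3 0 z"
proof -
  define s s2 c c2 t t2 where "s = th3 0 z" "s2 = th3 2 z" "c = th4 0 z" "c2 = th4 2 z" "t = th2 0 z" "t2 = th2 2 z"
  note d = this
  have 1: "4 * (c * s2 - s * c2) = t ^ 4 * s * c"
    using theta_wronskian_34[OF z] by (simp add: d)
  have 2: "t ^ 3 * t2 = s ^ 3 * s2 - c ^ 3 * c2"
    using theta_quadratic_relations(2)[OF z] by (simp add: d)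
  have 3: "s ^ 4 = c ^ 4 + t ^ 4" using theta_quartic[OF z] by (simp add: d)
  \<comment> \<open>The factor t^3 produces t^3 * t2, which the second quadratic relation expresses
    through s2 and c2; what remains is the Wronskian of theta_3 and theta_4.\<close>
  have "(t ^ 3 * c) * (4 * (s * t2 - t * s2)) = 4 * c * s * (t ^ 3 * t2) - 4 * c * s2 * t ^ 4"
    by (simp add: algebra_simps power3_eq_cube power4_eq_xxxx)
  also have "\<dots> = 4 * c * s2 * s ^ 4 - 4 * s * c ^ 4 * c2 - 4 * c * s2 * t ^ 4"
    unfolding 2 by (simp add: algebra_simps power3_eq_cube power4_eq_xxxx)
  also have "\<dots> = c ^ 4 * (4 * (c * s2 - s * c2))"
    unfolding 3 by (simp add: algebra_simps)
  also have "\<dots> = (t ^ 3 * c) * (c ^ 4 * t * s)"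
    unfolding 1 by (simp add: algebra_simps power3_eq_cube power4_eq_xxxx)
  finally show ?thesis using theta_nonzero[OF z] unfolding mult_cancel_left by (simp add: d)
qed

section \<open>Differential equations of second and third order for theta_3\<close>

lemma th_deriv [derivative_intros]:
  assumes "norm s \<le> 1" "Im z > 0" "D = \<i> * of_real pi * th a s (k + 2) z"
  shows "(th a s k has_field_derivative D) (at z)"
  using th_has_field_derivative[OF assms(1,2)] assms(3) by simp

lemma deriv_unique_upper_half_plane:
  assumes "(f has_field_derivative a) (at z)" "(g has_field_derivative b) (at z)"
    and "\<And>w. Im w > 0 \<Longrightarrow> f w = g w" "Im z > 0"
  shows "a = b"
proof -
  have "eventually (\<lambda>w. w \<in> {w. Im w > 0}) (nhds z)"
    using assms(4) by (intro eventually_nhds_in_open open_halfspace_Im_gt) auto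
  then have "\<forall>\<^sub>F w in nhds z. f w = g w"
    by eventually_elim (use assms(3) in auto)
  then have "(g has_field_derivative a) (at z)"
    using assms(1) DERIV_cong_ev[of z z f g a a] by simp
  then show ?thesis using assms(2) by (rule DERIV_unique)
qed

lemma theta_wronskian_34_deriv:
  assumes z: "Im z > 0"
  shows "4 * (th4 0 z * th3 4 z - th3 0 z * th4 4 z)
    = 4 * th2 0 z ^ 3 * th2 2 z * th3 0 z * th4 0 z + th2 0 z ^ 4 * (th3 2 z * th4 0 z + th3 0 z * th4 2 z)"
proof -
  \<comment> \<open>As d/dz = i pi q d/dq, this factor is common to the derivatives of both sides
    and cancels.\<close>
  define \<omega> where "\<omega> = \<i> * complex_of_real pi"
  have "\<omega> \<noteq> 0" by (simp add: \<omega>_def)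
  have "((\<lambda>z. 4 * (th4 0 z * th3 2 z - th3 0 z * th4 2 z)) has_field_derivative
     \<omega> * (4 * (th4 0 z * th3 4 z - th3 0 z * th4 4 z))) (at z)"
    by (rule derivative_eq_intros refl | simp add: z)+
       (simp add: \<omega>_def algebra_simps flip: numeral_2_eq_2)
  moreover have "((\<lambda>z. th2 0 z ^ 4 * th3 0 z * th4 0 z) has_field_derivative
     \<omega> * (4 * th2 0 z ^ 3 * th2 2 z * th3 0 z * th4 0 z + th2 0 z ^ 4 * (th3 2 z * th4 0 z + th3 0 z * th4 2 z))) (at z)"
    by (rule derivative_eq_intros refl | simp add: z)+
       (simp add: \<omega>_def algebra_simps flip: numeral_2_eq_2)
  ultimately show ?thesis
    using deriv_unique_upper_half_plane[OF _ _ theta_wronskian_34 z] \<open>\<omega> \<noteq> 0\<close> by fastforce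
qed

text \<open>With t_3 = D theta_3 / theta_3, the first fraction is D t_3 - 2 t_3^2; its numerator is
  the combination whose duplication formula carries the factor -4.\<close>

definition defect :: "complex \<Rightarrow> complex" where
  "defect z = (th3 0 z * th3 4 z - 3 * (th3 2 z)\<^sup>2) / (th3 0 z)\<^sup>2 - th2 0 z ^ 4 * th4 0 z ^ 4 / 8"

lemma defect_th3:
  assumes "Im z > 0"
  shows "8 * (th3 0 z * th3 4 z - 3 * (th3 2 z)\<^sup>2) = 8 * defect z * (th3 0 z)\<^sup>2 + th2 0 z ^ 4 * th4 0 z ^ 4 * (th3 0 z)\<^sup>2"
  using theta_nonzero[OF assms] by (simp add: defect_def field_simps)

text \<open>The difference of D t_3 - 2 t_3^2 and D t_4 - 2 t_4^2 is D (t_3 - t_4) - 2 (t_3 - t_4)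
  (t_3 + t_4). The Wronskian relations evaluate it as theta_2^4 (theta_3^4 + theta_4^4) / 8, so the
  same defect serves theta_4. The proof clears all denominators.\<close>

lemma defect_th4:
  assumes z: "Im z > 0"
  shows "8 * (th4 0 z * th4 4 z - 3 * (th4 2 z)\<^sup>2) = 8 * defect z * (th4 0 z)\<^sup>2 - th2 0 z ^ 4 * th3 0 z ^ 4 * (th4 0 z)\<^sup>2"
proof -
  define s s2 s4 c c2 c4 t t2 e where "s = th3 0 z" "s2 = th3 2 z" "s4 = th3 4 z"
    "c = th4 0 z" "c2 = th4 2 z" "c4 = th4 4 z" "t = th2 0 z" "t2 = th2 2 z" "e = defect z"
  note d = this
  have w34: "4 * (c * s2 - s * c2) = t ^ 4 * s * c"
    using theta_wronskian_34[OF z] by (simp add: d)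
  have w23: "4 * (s * t2 - t * s2) = c ^ 4 * t * s"
    using theta_wronskian_23[OF z] by (simp add: d)
  have dw: "4 * (c * s4 - s * c4) = 4 * t ^ 3 * t2 * s * c + t ^ 4 * (s2 * c + s * c2)"
    using theta_wronskian_34_deriv[OF z] by (simp add: d)
  have q: "s ^ 4 = c ^ 4 + t ^ 4" using theta_quartic[OF z] by (simp add: d)
  have F: "8 * (s * s4 - 3 * s2\<^sup>2) = 8 * e * s\<^sup>2 + t ^ 4 * c ^ 4 * s\<^sup>2"
    using defect_th3[OF z] by (simp add: d)
  have "8 * (s * s4 - 3 * s2\<^sup>2) * c\<^sup>2 - 8 * (c * c4 - 3 * c2\<^sup>2) * s\<^sup>2
     = 2 * s * c * (4 * (c * s4 - s * c4)) - 6 * (4 * (c * s2 - s * c2)) * (s2 * c + s * c2)"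
    by (simp add: algebra_simps power2_eq_square)
  also have "\<dots> = 2 * s * c * (4 * t ^ 3 * t2 * s * c + t ^ 4 * (s2 * c + s * c2)) - 6 * (t ^ 4 * s * c) * (s2 * c + s * c2)"
    by (simp only: dw w34)
  also have "\<dots> = 2 * s * c\<^sup>2 * t ^ 3 * (4 * (s * t2 - t * s2)) + t ^ 4 * s * c * (4 * (c * s2 - s * c2))"
    by (simp add: algebra_simps power2_eq_square power3_eq_cube power4_eq_xxxx)
  also have "\<dots> = s\<^sup>2 * c\<^sup>2 * t ^ 4 * (2 * c ^ 4 + t ^ 4)"
    unfolding w34 w23 by (simp add: algebra_simps power2_eq_square power3_eq_cube power4_eq_xxxx)
  also have "\<dots> = s\<^sup>2 * c\<^sup>2 * t ^ 4 * (c ^ 4 + s ^ 4)"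
    unfolding q by simp
  finally have "s\<^sup>2 * (8 * (c * c4 - 3 * c2\<^sup>2)) = s\<^sup>2 * (8 * e * c\<^sup>2 - t ^ 4 * s ^ 4 * c\<^sup>2)"
    unfolding F by (simp add: algebra_simps)
  moreover have "s\<^sup>2 \<noteq> 0" using theta_nonzero[OF z] by (simp add: d)
  ultimately show ?thesis unfolding mult_cancel_left by (simp add: d)
qed

text \<open>Adding the third integer duplication formula for sigma = 1 and sigma = -1 removes the
  theta_2 part and leaves F3 + F4 = -8 G. The theta products supplied by \<open>defect_th3\<close>
  and \<open>defect_th4\<close> then cancel against the one at 2 z.\<close>

lemma defect_duplication:
  assumes z: "Im z > 0"
  shows "defect z = - 4 * defect (2 * z)"
proof -
  define s c t S T C e E where "s = th3 0 z" "c = th4 0 z" "t = th2 0 z"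
    "S = th3 0 (2 * z)" "T = th2 0 (2 * z)" "C = th4 0 (2 * z)" "e = defect z" "E = defect (2 * z)"
  note d = this
  define F3 F4 G where "F3 = th3 0 z * th3 4 z - 3 * (th3 2 z)\<^sup>2" "F4 = th4 0 z * th4 4 z - 3 * (th4 2 z)\<^sup>2"
    "G = th3 0 (2 * z) * th3 4 (2 * z) - 3 * (th3 2 (2 * z))\<^sup>2"
  note dF = this
  have z2: "Im (2 * z) > 0" using z by simp
  note one = power_one[of 2] power2_minus[of "1 :: complex", unfolded power_one]
  have sq: "s\<^sup>2 = S\<^sup>2 + T\<^sup>2" "c\<^sup>2 = S\<^sup>2 - T\<^sup>2"
    using th_integer_duplication(1)[OF z one(1)] th_integer_duplication(1)[OF z one(2)] by (simp_all add: d)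
  have t: "t\<^sup>2 = 2 * S * T" using th_half_integer_duplication(1)[OF z] by (simp add: d)
  have C: "s * c = C\<^sup>2" using th_mixed_duplication(1)[OF z] by (simp add: d)
  have sum: "F3 + F4 = - 8 * G"
    using th_integer_duplication(3)[OF z one(1)] th_integer_duplication(3)[OF z one(2)] by (simp add: dF)
  have t4: "t ^ 4 = 4 * S\<^sup>2 * T\<^sup>2"
  proof -
    have "t ^ 4 = (t\<^sup>2)\<^sup>2" by simp
    then show ?thesis unfolding t by (simp add: power_mult_distrib)
  qed
  have "8 * F3 = 8 * e * s\<^sup>2 + t ^ 4 * (s * c)\<^sup>2 * c\<^sup>2"
    using defect_th3[OF z] by (simp add: d dF power2_eq_square power4_eq_xxxx mult_ac)
  moreover have "8 * F4 = 8 * e * c\<^sup>2 - t ^ 4 * (s * c)\<^sup>2 * s\<^sup>2"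
    using defect_th4[OF z] by (simp add: d dF power2_eq_square power4_eq_xxxx mult_ac)
  moreover have "8 * G = 8 * E * S\<^sup>2 + T ^ 4 * C ^ 4 * S\<^sup>2"
    using defect_th3[OF z2] by (simp add: d dF)
  moreover have "8 * F3 + 8 * F4 = - 8 * (8 * G)" using arg_cong[OF sum, of "\<lambda>x. 8 * x"] by (simp add: distrib_left)
  ultimately have "8 * e * s\<^sup>2 + t ^ 4 * (s * c)\<^sup>2 * c\<^sup>2 + (8 * e * c\<^sup>2 - t ^ 4 * (s * c)\<^sup>2 * s\<^sup>2)
      = - 8 * (8 * E * S\<^sup>2 + T ^ 4 * C ^ 4 * S\<^sup>2)" by simp
  then have "16 * S\<^sup>2 * e = 16 * S\<^sup>2 * (- 4 * E)"
    unfolding sq t4 C by (simp add: algebra_simps power2_eq_square power4_eq_xxxx)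
  moreover have "16 * S\<^sup>2 \<noteq> 0" using theta_nonzero[OF z2] by (simp add: d)
  ultimately show ?thesis unfolding mult_cancel_left by (simp add: d)
qed

lemma defect_eq_0:
  assumes z: "Im z > 0"
  shows "defect z = 0"
proof (rule constant_from_duplication[where c = "-4" and r = defect, OF defect_duplication z])
  have n: "norm (1 :: complex) \<le> 1" by simp
  define y where "y N = 2 ^ N * z" for N
  have lim: "(\<lambda>N. 4 ^ N * th3 k (y N)) \<longlonglongrightarrow> 0" if "k > 0" for k
    using th_integer_scaled_limit[OF n z, of k] that by (simp add: y_def)
  have lim': "(\<lambda>N. th3 k (y N)) \<longlonglongrightarrow> 0" if "k > 0" for k
    by (rule tendsto_of_scaled_zero) (use lim[OF that] in simp)
  have q: "(\<lambda>N. 4 ^ N * qpow (y N) 1) \<longlonglongrightarrow> 0"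
    using th_tail_tendsto[OF z, of "{0}" "\<lambda>_. 1" "\<lambda>_. 1"] by (simp add: y_def)
  note l = th_limits[OF z, folded y_def]
  \<comment> \<open>theta_2^4 is q times a convergent factor, and this q absorbs 4^N. In the
    fraction every product contains some \<open>th3 k\<close> with k > 0, which has no constant term
    and decays by itself.\<close>
  have "qpow (y N) 1 = qpow (y N) (1/4) ^ 4" for N
    by (simp add: qpow_def flip: exp_of_nat_mult)
  then have eq: "4 ^ N * defect (y N) = (th3 0 (y N) * (4 ^ N * th3 4 (y N)) - 3 * (th3 2 (y N) * (4 ^ N * th3 2 (y N)))) / (th3 0 (y N))\<^sup>2
     - 4 ^ N * qpow (y N) 1 * (th2 0 (y N) / qpow (y N) (1/4)) ^ 4 * th4 0 (y N) ^ 4 / 8" for N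
    by (simp add: defect_def power_divide right_diff_distrib diff_divide_distrib power2_eq_square mult_ac)
  have "(\<lambda>N. 4 ^ N * defect (y N)) \<longlonglongrightarrow> (1 * 0 - 3 * (0 * 0)) / 1\<^sup>2 - 0 * 2 ^ 4 * 1 ^ 4 / 8"
    unfolding eq by (intro tendsto_intros l lim lim' q) auto
  \<comment> \<open>Passing to norms allows 4^N to be exchanged for (-4)^N.\<close>
  then have "(\<lambda>N. norm (4 ^ N * defect (y N))) \<longlonglongrightarrow> 0"
    by (simp add: tendsto_norm_zero_iff)
  then have "(\<lambda>N. norm ((-4) ^ N * defect (y N))) \<longlonglongrightarrow> 0"
    by (simp add: norm_mult norm_power)
  then show "(\<lambda>N. (- 4) ^ N * defect (2 ^ N * z)) \<longlonglongrightarrow> 0"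
    unfolding tendsto_norm_zero_iff y_def .
qed

lemma theta3_second_order:
  assumes z: "Im z > 0"
  shows "8 * (th3 0 z * th3 4 z - 3 * (th3 2 z)\<^sup>2) = th2 0 z ^ 4 * th4 0 z ^ 4 * (th3 0 z)\<^sup>2"
  using defect_th3[OF z] defect_eq_0[OF z] by simp

text \<open>For the moments m_k = th3 k / theta_3 the bracket is theta_3^3 times the sixth cumulant
  m_6 - 15 m_4 m_2 + 30 m_2^3, just as the bracket in \<open>theta3_second_order\<close> is
  theta_3^2 times the fourth.\<close>

lemma theta3_third_order:
  assumes z: "Im z > 0"
  shows "8 * (th3 6 z * (th3 0 z)\<^sup>2 - 15 * th3 4 z * th3 2 z * th3 0 z + 30 * th3 2 z ^ 3)
    = (th4 0 z ^ 4 - th2 0 z ^ 4) * th2 0 z ^ 4 * th4 0 z ^ 4 * th3 0 z ^ 3"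
proof -
  define s s2 s4 s6 c c2 t t2 where "s = th3 0 z" "s2 = th3 2 z" "s4 = th3 4 z" "s6 = th3 6 z"
    "c = th4 0 z" "c2 = th4 2 z" "t = th2 0 z" "t2 = th2 2 z"
  note d = this
  define \<omega> where "\<omega> = \<i> * complex_of_real pi"
  have "\<omega> \<noteq> 0" by (simp add: \<omega>_def)
  have "((\<lambda>z. 8 * (th3 0 z * th3 4 z - 3 * (th3 2 z)\<^sup>2)) has_field_derivative
     \<omega> * (8 * (s * s6 - 5 * s2 * s4))) (at z)"
    by (rule derivative_eq_intros refl | simp add: z)+
       (simp add: \<omega>_def d algebra_simps flip: numeral_2_eq_2)
  moreover have "((\<lambda>z. th2 0 z ^ 4 * th4 0 z ^ 4 * (th3 0 z)\<^sup>2) has_field_derivative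
     \<omega> * (4 * t ^ 3 * t2 * c ^ 4 * s\<^sup>2 + 4 * t ^ 4 * c ^ 3 * c2 * s\<^sup>2 + 2 * t ^ 4 * c ^ 4 * s * s2)) (at z)"
    by (rule derivative_eq_intros refl | simp add: z)+
       (simp add: \<omega>_def d algebra_simps flip: numeral_2_eq_2)
  ultimately have D: "8 * (s * s6 - 5 * s2 * s4)
      = 4 * t ^ 3 * t2 * c ^ 4 * s\<^sup>2 + 4 * t ^ 4 * c ^ 3 * c2 * s\<^sup>2 + 2 * t ^ 4 * c ^ 4 * s * s2"
    using deriv_unique_upper_half_plane[OF _ _ theta3_second_order z] \<open>\<omega> \<noteq> 0\<close> by fastforce
  have w34: "4 * (c * s2 - s * c2) = t ^ 4 * s * c"
    using theta_wronskian_34[OF z] by (simp add: d)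
  have w23: "4 * (s * t2 - t * s2) = c ^ 4 * t * s"
    using theta_wronskian_23[OF z] by (simp add: d)
  have F: "8 * (s * s4 - 3 * s2\<^sup>2) = t ^ 4 * c ^ 4 * s\<^sup>2"
    using theta3_second_order[OF z] by (simp add: d)
  \<comment> \<open>The multiple 10 * s2 of the second order equation corrects the coefficient of s4
    * s2 from -5 to -15; the right-hand sides then combine into Wronskians.\<close>
  have "8 * (s6 * s\<^sup>2 - 15 * s4 * s2 * s + 30 * s2 ^ 3)
      = s * (8 * (s * s6 - 5 * s2 * s4)) - 10 * s2 * (8 * (s * s4 - 3 * s2\<^sup>2))"
    by (simp add: algebra_simps power2_eq_square power3_eq_cube)
  also have "\<dots> = t ^ 3 * c ^ 4 * s\<^sup>2 * (4 * (s * t2 - t * s2)) - t ^ 4 * c ^ 3 * s\<^sup>2 * (4 * (c * s2 - s * c2))"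
    unfolding D F by (simp add: algebra_simps power2_eq_square power3_eq_cube power4_eq_xxxx)
  also have "\<dots> = (c ^ 4 - t ^ 4) * t ^ 4 * c ^ 4 * s ^ 3"
    unfolding w34 w23 by (simp add: algebra_simps power2_eq_square power3_eq_cube power4_eq_xxxx)
  finally show ?thesis by (simp add: d)
qed

subsection \<open>Theta series of the cubic lattice\<close>

lemma theta2_eq: "theta2 z = th2 0 z"
  by (simp add: theta2_def th_def chi_def)

lemma theta3_eq: "theta3 z = th3 0 z"
  by (simp add: theta3_def th_def chi_def)

lemma theta4_eq: "theta4 z = th4 0 z"
proof -
  have "(-1 :: complex) ^ nat (m\<^sup>2) = chi (-1) m" for m :: int
  proof -
    have "even (nat (m\<^sup>2)) \<longleftrightarrow> even m" by (simp add: even_nat_iff)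
    then show ?thesis by (simp add: chi_def)
  qed
  then show ?thesis by (simp add: theta4_def th_def)
qed

lemma finite_multi_indices: "finite {\<alpha> :: 'n::finite \<Rightarrow> nat. sum \<alpha> UNIV = j}"
proof (rule finite_subset)
  show "{\<alpha>. sum \<alpha> UNIV = j} \<subseteq> PiE (UNIV :: 'n set) (\<lambda>_. {..j})"
    by (auto simp: PiE_def extensional_def intro: member_le_sum)
  show "finite (PiE (UNIV :: 'n set) (\<lambda>_. {..j}))"
    by (intro finite_PiE) auto
qed

lemma qpow_sum: "qpow z (sum f A) = (\<Prod>i\<in>A. qpow z (f i))"
  by (induction A rule: infinite_finite_induct) (auto simp: qpow_add, auto simp: qpow_def)

text \<open>As <x, x> is the sum of the squared coordinates, the summand factors over the
  coordinates and the lattice sum becomes a product of sums over the integers.\<close>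

lemma th_monomial_has_sum:
  fixes \<alpha> :: "'n::finite \<Rightarrow> nat"
  assumes z: "Im z > 0"
  shows "((\<lambda>x. of_real (\<Prod>i\<in>UNIV. (x $ i) ^ \<alpha> i) * qpow z (x \<bullet> x)) has_sum (\<Prod>i\<in>UNIV. th3 (\<alpha> i) z))
    (cubic_lattice :: (real ^ 'n) set)"
proof -
  define f where "f i = (\<lambda>m::int. of_real (of_int m ^ \<alpha> i) * qpow z ((of_int m)\<^sup>2))" for i
  have n: "norm (1 :: complex) \<le> 1" by simp
  have s: "(\<lambda>m. norm (f i m)) summable_on UNIV" for i
    using th_abs_summable[OF n z, of 0 "\<alpha> i"] by (simp add: f_def chi_def)
  have U: "PiE (UNIV :: 'n set) (\<lambda>_. UNIV :: int set) = UNIV" by (auto simp: PiE_def extensional_def)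
  have "(\<lambda>g. norm (\<Prod>i\<in>UNIV. f i (g i))) summable_on PiE (UNIV :: 'n set) (\<lambda>_. UNIV)"
    unfolding abs_summable_equivalent
    by (rule Infinite_Set_Sum.abs_summable_on_prod_PiE) (use s in \<open>auto simp: abs_summable_equivalent\<close>)
  then have "(\<lambda>g. \<Prod>i\<in>UNIV. f i (g i)) summable_on UNIV"
    unfolding U by (rule abs_summable_summable)
  moreover have "infsum (\<lambda>g. \<Prod>i\<in>UNIV. f i (g i)) UNIV = (\<Prod>i\<in>UNIV. infsum (f i) UNIV)"
    using infsum_prod_PiE_abs[of "UNIV :: 'n set" f "\<lambda>_. UNIV", OF _ s] unfolding U by simp
  ultimately have "((\<lambda>g. \<Prod>i\<in>UNIV. f i (g i)) has_sum (\<Prod>i\<in>UNIV. infsum (f i) UNIV)) UNIV"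
    by (metis has_sum_infsum)
  also have "(\<Prod>i\<in>UNIV. infsum (f i) UNIV) = (\<Prod>i\<in>UNIV. th3 (\<alpha> i) z)"
    by (simp add: f_def th_def chi_def)
  finally have g: "((\<lambda>g. \<Prod>i\<in>UNIV. f i (g i)) has_sum (\<Prod>i\<in>UNIV. th3 (\<alpha> i) z)) UNIV" .
  have "bij_betw (\<lambda>g. \<chi> i. of_int (g i)) (UNIV :: ('n \<Rightarrow> int) set) (cubic_lattice :: (real ^ 'n) set)"
    by (rule bij_betw_byWitness[where f' = "\<lambda>x i. \<lfloor>x $ i\<rfloor>"])
       (auto simp: cubic_lattice_def vec_eq_iff elim!: Ints_cases)
  then show ?thesis
    by (subst has_sum_reindex_bij_betw[symmetric])
       (use g in \<open>auto simp: f_def inner_vec_def qpow_sum prod.distrib power2_eq_square\<close>)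
qed

lemma theta_series_polynomial:
  fixes c :: "('n::finite \<Rightarrow> nat) \<Rightarrow> real"
  assumes z: "Im z > 0"
  shows "theta_series (cubic_lattice :: (real ^ 'n) set) (\<lambda>x. \<Sum>\<alpha>\<in>A. c \<alpha> * (\<Prod>i\<in>UNIV. (x $ i) ^ \<alpha> i)) z
    = (\<Sum>\<alpha>\<in>A. of_real (c \<alpha>) * (\<Prod>i\<in>UNIV. th3 (\<alpha> i) z))"
proof -
  have "((\<lambda>x. \<Sum>\<alpha>\<in>A. of_real (c \<alpha>) * (of_real (\<Prod>i\<in>UNIV. (x $ i) ^ \<alpha> i) * qpow z (x \<bullet> x))) has_sum
     (\<Sum>\<alpha>\<in>A. of_real (c \<alpha>) * (\<Prod>i\<in>UNIV. th3 (\<alpha> i) z))) (cubic_lattice :: (real ^ 'n) set)"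
    by (induction A rule: infinite_finite_induct)
       (auto intro!: has_sum_add has_sum_cmult_right th_monomial_has_sum z simp del: of_real_prod of_real_power)
  then show ?thesis
    unfolding theta_series_def by (intro infsumI) (simp add: sum_distrib_right mult.assoc)
qed

section \<open>The Laplacian and the Gaussian functional\<close>

definition monomial_laplacian :: "('n::finite \<Rightarrow> nat) \<Rightarrow> real ^ 'n \<Rightarrow> real" where
  "monomial_laplacian \<alpha> x = (\<Sum>k\<in>UNIV. real (\<alpha> k * (\<alpha> k - 1)) * (\<Prod>i\<in>UNIV. (x $ i) ^ (\<alpha>(k := \<alpha> k - 2)) i))"

text \<open>Along the k-th axis only the k-th factor of a monomial varies. The truncated subtraction
  in the exponent is harmless, since the coefficient vanishes for
  \<open>\<alpha> k \<le> 1\<close>.\<close>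

lemma laplacian_polynomial:
  fixes c :: "('n::finite \<Rightarrow> nat) \<Rightarrow> real"
  shows "laplacian (\<lambda>x. \<Sum>\<alpha>\<in>A. c \<alpha> * (\<Prod>i\<in>UNIV. (x $ i) ^ \<alpha> i)) x = (\<Sum>\<alpha>\<in>A. c \<alpha> * monomial_laplacian \<alpha> x)"
proof -
  have split: "(\<Prod>i\<in>UNIV. f i) = f k * (\<Prod>i\<in>UNIV - {k}. f i)" for f :: "'n \<Rightarrow> real" and k
    by (subst prod.remove[of _ k]) auto
  define R where "R \<alpha> k = (\<Prod>i\<in>UNIV - {k}. (x $ i) ^ \<alpha> i)" for \<alpha> k
  have line: "(\<Prod>i\<in>UNIV. ((x + t *\<^sub>R axis k 1) $ i) ^ \<alpha> i) = (x $ k + t) ^ \<alpha> k * R \<alpha> k" for t k \<alpha>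
    unfolding split[of _ k] R_def
    by (intro arg_cong2[where f = "(*)"] prod.cong) (auto simp: axis_def)
  have d1: "deriv (\<lambda>t. \<Sum>\<alpha>\<in>A. c \<alpha> * ((x $ k + t) ^ \<alpha> k * R \<alpha> k)) s
      = (\<Sum>\<alpha>\<in>A. c \<alpha> * (real (\<alpha> k) * (x $ k + s) ^ (\<alpha> k - 1) * R \<alpha> k))" for k s
    by (rule DERIV_imp_deriv) (rule derivative_eq_intros refl | simp add: mult_ac)+
  have d2: "deriv (\<lambda>s. \<Sum>\<alpha>\<in>A. c \<alpha> * (real (\<alpha> k) * (x $ k + s) ^ (\<alpha> k - 1) * R \<alpha> k)) 0
      = (\<Sum>\<alpha>\<in>A. c \<alpha> * (real (\<alpha> k) * (real (\<alpha> k - 1) * (x $ k + 0) ^ (\<alpha> k - 1 - 1)) * R \<alpha> k))" for k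
    by (rule DERIV_imp_deriv) (rule derivative_eq_intros refl | simp add: mult_ac)+
  have R: "(\<Prod>i\<in>UNIV. (x $ i) ^ (\<alpha>(k := \<alpha> k - 2)) i) = (x $ k) ^ (\<alpha> k - 1 - 1) * R \<alpha> k" for \<alpha> k
    unfolding split[of _ k] R_def by (simp add: numeral_2_eq_2)
  show ?thesis
    unfolding laplacian_def line d1 d2 monomial_laplacian_def R sum_distrib_left
    by (subst sum.swap) (simp add: mult_ac)
qed

text \<open>The moments of the standard normal distribution: (a - 1)!! for even a and 0 for odd a.
  The recursion is integration by parts.\<close>

fun gauss_moment :: "nat \<Rightarrow> real" where
  "gauss_moment 0 = 1"
| "gauss_moment (Suc 0) = 0"
| "gauss_moment (Suc (Suc a)) = real (Suc a) * gauss_moment a"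

text \<open>The three-point Gauss--Hermite rule represents the Gaussian functional by point evaluations, so that it
  can be applied to a polynomial known only as a function.\<close>
lemma gauss_quadrature:
  assumes "a \<le> 5"
  shows "(\<Sum>p\<in>{0, sqrt 3, - sqrt 3}. (if p = 0 then 2/3 else 1/6) * p ^ a) = gauss_moment a"
proof -
  have [simp]: "sqrt 3 \<noteq> - sqrt 3" "- sqrt 3 \<noteq> sqrt 3"
    by (metis neg_equal_zero real_sqrt_eq_zero_cancel_iff zero_neq_numeral)+
  have "a = 0 \<or> a = 1 \<or> a = 2 \<or> a = 3 \<or> a = 4 \<or> a = 5" using assms by auto
  then show ?thesis
    by (elim disjE) (simp_all add: eval_nat_numeral)
qed

text \<open>The Gaussian functional E satisfies E (Laplacian of P) = j E P for homogeneous P of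
  degree j. The vanishing of the Laplacian is given pointwise, so E is realized by quadrature; the
  exponents in the Laplacian are at most 5, where the quadrature is exact.\<close>

lemma harmonic_gauss_moment_zero:
  fixes c :: "('n::finite \<Rightarrow> nat) \<Rightarrow> real"
  assumes harm: "\<And>x. (\<Sum>\<alpha>\<in>{\<alpha>. sum \<alpha> UNIV = j}. c \<alpha> * monomial_laplacian \<alpha> x) = 0"
    and j: "0 < j" "j \<le> 7"
  shows "(\<Sum>\<alpha>\<in>{\<alpha>. sum \<alpha> UNIV = j}. c \<alpha> * (\<Prod>i\<in>UNIV. gauss_moment (\<alpha> i))) = 0"
proof -
  define T where "T = {0, sqrt 3, - sqrt 3 :: real}"
  define w where "w p = (if p = 0 then 2/3 else 1/6 :: real)" for p :: real
  define E where "E f = (\<Sum>p\<in>PiE (UNIV :: 'n set) (\<lambda>_. T). (\<Prod>i\<in>UNIV. w (p i)) * f (\<chi> i. p i))"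
    for f :: "real ^ 'n \<Rightarrow> real"
  have Emono: "E (\<lambda>x. \<Prod>i\<in>UNIV. (x $ i) ^ \<beta> i) = (\<Prod>i\<in>UNIV. gauss_moment (\<beta> i))" if "\<And>i. \<beta> i \<le> 5" for \<beta>
  proof -
    have "(\<Prod>i\<in>(UNIV :: 'n set). \<Sum>p\<in>T. w p * p ^ \<beta> i) = (\<Sum>p\<in>PiE UNIV (\<lambda>_. T). \<Prod>i\<in>UNIV. w (p i) * p i ^ \<beta> i)"
      by (rule prod_sum_PiE) (auto simp: T_def)
    moreover have "(\<Sum>p\<in>T. w p * p ^ \<beta> i) = gauss_moment (\<beta> i)" for i
      unfolding T_def w_def by (rule gauss_quadrature[OF that])
    ultimately show ?thesis by (simp add: E_def prod.distrib)
  qed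
  have Elap: "E (monomial_laplacian \<alpha>) = real j * (\<Prod>i\<in>UNIV. gauss_moment (\<alpha> i))" if \<alpha>: "sum \<alpha> UNIV = j" for \<alpha>
  proof -
    have "E (monomial_laplacian \<alpha>)
        = (\<Sum>k\<in>UNIV. real (\<alpha> k * (\<alpha> k - 1)) * E (\<lambda>x. \<Prod>i\<in>UNIV. (x $ i) ^ (\<alpha>(k := \<alpha> k - 2)) i))"
      unfolding E_def monomial_laplacian_def sum_distrib_left by (subst sum.swap) (simp add: mult_ac)
    \<comment> \<open>By the recursion the factor \<open>\<alpha> k - 1\<close> restores the full
      moment, leaving \<open>\<alpha> k\<close>; these add up to j.\<close>
    also have "\<dots> = (\<Sum>k\<in>UNIV. real (\<alpha> k) * (\<Prod>i\<in>UNIV. gauss_moment (\<alpha> i)))"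
    proof (rule sum.cong)
      fix k
      show "real (\<alpha> k * (\<alpha> k - 1)) * E (\<lambda>x. \<Prod>i\<in>UNIV. (x $ i) ^ (\<alpha>(k := \<alpha> k - 2)) i)
          = real (\<alpha> k) * (\<Prod>i\<in>UNIV. gauss_moment (\<alpha> i))"
      proof (cases "\<alpha> k \<ge> 2")
        case True
        then obtain a where a: "\<alpha> k = Suc (Suc a)" by (metis add_2_eq_Suc le_Suc_ex)
        have sum: "\<alpha> k + sum \<alpha> (UNIV - {k}) = j"
          using \<alpha> by (subst (asm) sum.remove[of _ k]) auto
        have "(\<alpha>(k := \<alpha> k - 2)) i \<le> 5" for i
        proof (cases "i = k")
          case False
          then have "\<alpha> i \<le> sum \<alpha> (UNIV - {k})" by (intro member_le_sum) auto
          then show ?thesis using sum True j False by auto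
        qed (use sum j in auto)
        then have "E (\<lambda>x. \<Prod>i\<in>UNIV. (x $ i) ^ (\<alpha>(k := \<alpha> k - 2)) i) = (\<Prod>i\<in>UNIV. gauss_moment ((\<alpha>(k := \<alpha> k - 2)) i))"
          by (rule Emono)
        also have "\<dots> = gauss_moment a * (\<Prod>i\<in>UNIV - {k}. gauss_moment (\<alpha> i))"
          by (subst prod.remove[of _ k]) (auto simp: a)
        finally show ?thesis
          by (subst (2) prod.remove[of _ k]) (auto simp: a algebra_simps)
      next
        case False
        then have "\<alpha> k = 0 \<or> \<alpha> k = 1" by auto
        moreover have "(\<Prod>i\<in>UNIV. gauss_moment (\<alpha> i)) = 0" if "\<alpha> k = 1"
          by (rule prod_zero) (use that in \<open>auto intro!: exI[of _ k]\<close>)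
        ultimately show ?thesis by auto
      qed
    qed simp
    also have "\<dots> = real j * (\<Prod>i\<in>UNIV. gauss_moment (\<alpha> i))"
      by (simp add: sum_distrib_right[symmetric] \<alpha>[symmetric])
    finally show ?thesis .
  qed
  have "0 = E (\<lambda>x. \<Sum>\<alpha>\<in>{\<alpha>. sum \<alpha> UNIV = j}. c \<alpha> * monomial_laplacian \<alpha> x)"
    by (simp add: harm E_def)
  also have "\<dots> = (\<Sum>\<alpha>\<in>{\<alpha>. sum \<alpha> UNIV = j}. c \<alpha> * E (monomial_laplacian \<alpha>))"
    unfolding E_def sum_distrib_left by (subst sum.swap) (simp add: mult_ac)
  also have "\<dots> = real j * (\<Sum>\<alpha>\<in>{\<alpha>. sum \<alpha> UNIV = j}. c \<alpha> * (\<Prod>i\<in>UNIV. gauss_moment (\<alpha> i)))"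
    by (simp add: Elap sum_distrib_left mult_ac)
  finally show ?thesis using j by simp
qed

section \<open>Values at the coordinate vectors and cumulant expansions\<close>

lemma prod_axis_power:
  "(\<Prod>k\<in>UNIV. (axis i (1::real) $ k) ^ \<beta> k) = (if \<forall>k. k \<noteq> i \<longrightarrow> \<beta> k = 0 then 1 else 0)"
proof (cases "\<forall>k. k \<noteq> i \<longrightarrow> \<beta> k = 0")
  case True
  then show ?thesis by (auto intro!: prod.neutral simp: axis_def)
next
  case False
  then obtain k where "k \<noteq> i" "\<beta> k \<noteq> 0" by auto
  then have "(\<Prod>k\<in>UNIV. (axis i (1::real) $ k) ^ \<beta> k) = 0"
    by (intro prod_zero) (auto intro!: bexI[of _ k] simp: axis_def)
  with False show ?thesis by (simp only: if_False)
qed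

lemma monomial_axis:
  assumes "sum \<alpha> UNIV = (j :: nat)"
  shows "(\<Prod>k\<in>UNIV. (axis i (1::real) $ k) ^ \<alpha> k) = (if \<alpha> i = j then 1 else 0)"
proof -
  have "\<alpha> i + sum \<alpha> (UNIV - {i}) = j"
    using assms by (subst (asm) sum.remove[of _ i]) auto
  then have "\<alpha> i = j \<longleftrightarrow> (\<forall>k. k \<noteq> i \<longrightarrow> \<alpha> k = 0)" by (auto simp: sum_eq_0_iff)
  then show ?thesis unfolding prod_axis_power by simp
qed

text \<open>At e_i only pure powers of x_i survive. A second derivative of the monomial leaves one
  only for x_i^j, or for x_i^(j - 2) times the square of another coordinate; the sum over k is 0 for
  a product of two different ones.\<close>

lemma monomial_laplacian_axis:
  assumes "sum \<alpha> UNIV = (j :: nat)" "j \<ge> 2"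
  shows "monomial_laplacian \<alpha> (axis i 1) = (if \<alpha> i = j then real (j * (j - 1))
     else if \<alpha> i = j - 2 then (\<Sum>k\<in>UNIV - {i}. real (\<alpha> k * (\<alpha> k - 1))) else 0)"
proof -
  have si: "\<alpha> i + sum \<alpha> (UNIV - {i}) = j"
    using assms by (subst (asm) sum.remove[of _ i]) auto
  have ai: "\<alpha> i = j \<longleftrightarrow> (\<forall>k. k \<noteq> i \<longrightarrow> \<alpha> k = 0)"
    using si by (auto simp: sum_eq_0_iff)
  have 1: "real (\<alpha> i * (\<alpha> i - 1)) * (\<Prod>m\<in>UNIV. (axis i (1::real) $ m) ^ (\<alpha>(i := \<alpha> i - 2)) m)
      = (if \<alpha> i = j then real (j * (j - 1)) else 0)"
    unfolding prod_axis_power using ai by auto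
  have 2: "real (\<alpha> k * (\<alpha> k - 1)) * (\<Prod>m\<in>UNIV. (axis i (1::real) $ m) ^ (\<alpha>(k := \<alpha> k - 2)) m)
      = (if \<alpha> i = j - 2 then real (\<alpha> k * (\<alpha> k - 1)) else 0)" if "k \<noteq> i" for k
  proof (cases "\<alpha> k \<ge> 2")
    case True
    have "\<alpha> k + sum \<alpha> (UNIV - {i} - {k}) = sum \<alpha> (UNIV - {i})"
      using that by (subst (2) sum.remove[of _ k]) auto
    then have sk: "\<alpha> i + \<alpha> k + sum \<alpha> (UNIV - {i} - {k}) = j" using si by simp
    have "\<alpha> i = j - 2 \<longleftrightarrow> \<alpha> k - 2 = 0 \<and> sum \<alpha> (UNIV - {i} - {k}) = 0"
      using sk True by (auto simp del: sum_eq_0_iff)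
    also have "\<dots> \<longleftrightarrow> (\<forall>m. m \<noteq> i \<longrightarrow> (\<alpha>(k := \<alpha> k - 2)) m = 0)"
      using that by (auto simp: sum_eq_0_iff)
    finally have eq: "\<alpha> i = j - 2 \<longleftrightarrow> (\<forall>m. m \<noteq> i \<longrightarrow> (\<alpha>(k := \<alpha> k - 2)) m = 0)" .
    show ?thesis unfolding prod_axis_power eq[symmetric] by simp
  next
    case False
    then have "\<alpha> k = 0 \<or> \<alpha> k = 1" by auto
    then show ?thesis by auto
  qed
  have "monomial_laplacian \<alpha> (axis i 1) = (if \<alpha> i = j then real (j * (j - 1)) else 0)
     + (\<Sum>k\<in>UNIV - {i}. if \<alpha> i = j - 2 then real (\<alpha> k * (\<alpha> k - 1)) else 0)"
    unfolding monomial_laplacian_def sum.remove[OF finite_class.finite_UNIV UNIV_I[of i]] 1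
    by (intro arg_cong2[where f = "(+)"] refl sum.cong 2) auto
  moreover have "(\<Sum>k\<in>UNIV - {i}. real (\<alpha> k * (\<alpha> k - 1))) = 0" if "\<alpha> i = j"
    using that ai by auto
  ultimately show ?thesis using assms(2) by auto
qed

text \<open>Up to order 3 the moments are those of a centred Gaussian of variance rho^2. Using a
  root rho of the variance lets each factor be scaled separately, also for odd exponents.\<close>

lemma prod_low_moments:
  fixes s :: "nat \<Rightarrow> complex"
  assumes s: "s 0 = 1" "s 1 = 0" "s 2 = \<rho>\<^sup>2" "s 3 = 0" and \<alpha>: "\<And>i. i \<in> A \<Longrightarrow> \<alpha> i \<le> 3"
  shows "(\<Prod>i\<in>A. s (\<alpha> i)) = \<rho> ^ sum \<alpha> A * of_real (\<Prod>i\<in>A. gauss_moment (\<alpha> i))"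
proof -
  have "s a = \<rho> ^ a * of_real (gauss_moment a)" if "a \<le> 3" for a
  proof -
    have "a = 0 \<or> a = 1 \<or> a = 2 \<or> a = 3" using that by auto
    then show ?thesis using s by (elim disjE) (simp_all add: eval_nat_numeral)
  qed
  then have "(\<Prod>i\<in>A. s (\<alpha> i)) = (\<Prod>i\<in>A. \<rho> ^ \<alpha> i * of_real (gauss_moment (\<alpha> i)))"
    using \<alpha> by (intro prod.cong) auto
  then show ?thesis by (simp add: prod.distrib power_sum)
qed

lemma gauss_moment_values:
  "gauss_moment 2 = 1" "gauss_moment 3 = 0" "gauss_moment 4 = 3" "gauss_moment 5 = 0" "gauss_moment 6 = 15"
  by (simp_all add: eval_nat_numeral)

text \<open>Here \<open>\<kappa>4\<close> and \<open>\<kappa>6\<close> are the cumulants of the moment sequence \<open>s\<close>, whose variance is \<open>\<rho>\<^sup>2\<close>.\<close>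
lemma moments_degree_4:
  fixes s :: "nat \<Rightarrow> complex" and \<alpha> :: "'n::finite \<Rightarrow> nat"
  assumes s: "s 0 = 1" "s 1 = 0" "s 2 = \<rho>\<^sup>2" "s 3 = 0" "s 4 = 3 * \<rho> ^ 4 + \<kappa>4"
    and \<alpha>: "sum \<alpha> UNIV = 4"
  shows "(\<Prod>i\<in>UNIV. s (\<alpha> i)) = \<rho> ^ 4 * of_real (\<Prod>i\<in>UNIV. gauss_moment (\<alpha> i))
     + \<kappa>4 * of_real (\<Sum>i\<in>UNIV. \<Prod>k\<in>UNIV. (axis i (1::real) $ k) ^ \<alpha> k)"
proof (cases "\<exists>i. \<alpha> i = 4")
  case True
  then obtain i where i: "\<alpha> i = 4" by auto
  have "\<alpha> i + sum \<alpha> (UNIV - {i}) = 4"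
    using \<alpha> by (subst (asm) sum.remove[of _ i]) auto
  then have z: "\<alpha> k = 0" if "k \<noteq> i" for k using i that by (auto simp: sum_eq_0_iff)
  have "\<alpha> m = 4 \<longleftrightarrow> m = i" for m using i z[of m] by (cases "m = i") auto
  moreover have "(\<Prod>k\<in>UNIV - {i}. s (\<alpha> k)) = 1" "(\<Prod>k\<in>UNIV - {i}. gauss_moment (\<alpha> k)) = 1"
    using z s by (auto intro!: prod.neutral)
  ultimately show ?thesis
    by (simp add: monomial_axis[OF \<alpha>] prod.remove[of UNIV i] i s gauss_moment_values algebra_simps)
next
  case False
  have "\<alpha> i \<le> 3" for i
  proof -
    have "\<alpha> i \<le> 4" using member_le_sum[of i UNIV \<alpha>] \<alpha> by simp
    moreover have "\<alpha> i \<noteq> 4" using False by auto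
    ultimately show ?thesis by linarith
  qed
  then show ?thesis
    using False by (subst prod_low_moments[OF s(1-4)]) (auto simp: \<alpha> monomial_axis[OF \<alpha>])
qed

text \<open>A monomial of degree 2 is a square, with value 2 on both sides, or a product of two
  coordinates, with value 0. This links the Laplacian at e_i of x_i^4 times such a monomial to the
  Gaussian moment.\<close>

lemma sum_falling_eq_gauss:
  assumes "finite A" "sum \<alpha> A = (2::nat)"
  shows "(\<Sum>k\<in>A. real (\<alpha> k * (\<alpha> k - 1))) = 2 * (\<Prod>k\<in>A. gauss_moment (\<alpha> k))"
proof (cases "\<exists>k\<in>A. \<alpha> k = 2")
  case True
  then obtain k where k: "k \<in> A" "\<alpha> k = 2" by auto
  have "\<alpha> k + sum \<alpha> (A - {k}) = 2"
    using assms k by (subst (asm) sum.remove[of _ k]) auto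
  then have "\<forall>m\<in>A - {k}. \<alpha> m = 0" using k assms by (auto simp: sum_eq_0_iff)
  then show ?thesis
    using assms k by (simp add: sum.remove[of A k] prod.remove[of A k] gauss_moment_values prod.neutral)
next
  case False
  have 1: "\<alpha> k = 0 \<or> \<alpha> k = 1" if "k \<in> A" for k
  proof -
    have "\<alpha> k \<le> 2" using member_le_sum[of k A \<alpha>] assms that by simp
    moreover have "\<alpha> k \<noteq> 2" using False that by auto
    ultimately show ?thesis by linarith
  qed
  obtain k where "k \<in> A" "\<alpha> k \<noteq> 0" using assms by (metis sum.neutral zero_neq_numeral)
  then have "k \<in> A" "\<alpha> k = 1" using 1[of k] by auto
  then have "(\<Prod>k\<in>A. gauss_moment (\<alpha> k)) = 0" using assms by (intro prod_zero) (auto intro!: bexI[of _ k])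
  moreover have "(\<Sum>k\<in>A. real (\<alpha> k * (\<alpha> k - 1))) = 0" by (intro sum.neutral ballI) (drule 1, auto)
  ultimately show ?thesis by simp
qed

text \<open>At most one exponent reaches 4; if none does, both correction terms vanish. For x_i^4
  x_k^2 the Laplacian at e_i is 2 and for x_i^6 it is 30; halved, these are the coefficients 1 and
  15 of \<open>\<kappa>4 * \<rho>\<^sup>2\<close>.\<close>

lemma moments_degree_6:
  fixes s :: "nat \<Rightarrow> complex" and \<alpha> :: "'n::finite \<Rightarrow> nat"
  assumes s: "s 0 = 1" "s 1 = 0" "s 2 = \<rho>\<^sup>2" "s 3 = 0" "s 4 = 3 * \<rho> ^ 4 + \<kappa>4" "s 5 = 0"
      "s 6 = 15 * \<rho> ^ 6 + 15 * \<kappa>4 * \<rho>\<^sup>2 + \<kappa>6"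
    and \<alpha>: "sum \<alpha> UNIV = 6"
  shows "(\<Prod>i\<in>UNIV. s (\<alpha> i)) = \<rho> ^ 6 * of_real (\<Prod>i\<in>UNIV. gauss_moment (\<alpha> i))
     + \<kappa>6 * of_real (\<Sum>i\<in>UNIV. \<Prod>k\<in>UNIV. (axis i (1::real) $ k) ^ \<alpha> k)
     + \<kappa>4 * \<rho>\<^sup>2 / 2 * of_real (\<Sum>i\<in>UNIV. monomial_laplacian \<alpha> (axis i 1))"
proof (cases "\<exists>i. \<alpha> i \<ge> 4")
  case True
  then obtain i where i: "\<alpha> i \<ge> 4" by auto
  have sum: "\<alpha> i + sum \<alpha> (UNIV - {i}) = 6"
    using \<alpha> by (subst (asm) sum.remove[of _ i]) auto
  have k2: "\<alpha> k \<le> 2" if "k \<noteq> i" for k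
    using member_le_sum[of k "UNIV - {i}" \<alpha>] sum i that by simp
  have other: "\<alpha> k \<noteq> 6" "\<alpha> k \<noteq> 4" if "k \<noteq> i" for k using k2[OF that] by auto
  define L where "L m = (if \<alpha> m = 6 then 30 else if \<alpha> m = 4 then \<Sum>k\<in>UNIV - {m}. real (\<alpha> k * (\<alpha> k - 1)) else 0)" for m
  have lap: "monomial_laplacian \<alpha> (axis m 1) = L m" for m
    by (simp add: monomial_laplacian_axis[OF \<alpha>] L_def)
  have sumL: "(\<Sum>m\<in>UNIV. L m) = L i"
    by (subst sum.remove[of _ i]) (auto intro!: sum.neutral simp: L_def other)
  have sumA: "(\<Sum>m\<in>UNIV. if \<alpha> m = 6 then 1 else 0 :: real) = (if \<alpha> i = 6 then 1 else 0)"
    by (subst sum.remove[of _ i]) (auto intro!: sum.neutral simp: other)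
  have "(\<Prod>k\<in>UNIV - {i}. s (\<alpha> k)) = \<rho> ^ sum \<alpha> (UNIV - {i}) * of_real (\<Prod>k\<in>UNIV - {i}. gauss_moment (\<alpha> k))"
    by (rule prod_low_moments[OF s(1-4)]) (use k2 in force)
  then have prod: "(\<Prod>k\<in>UNIV. s (\<alpha> k)) = s (\<alpha> i) * (\<rho> ^ sum \<alpha> (UNIV - {i}) * of_real (\<Prod>k\<in>UNIV - {i}. gauss_moment (\<alpha> k)))"
    by (subst prod.remove[of _ i]) auto
  have gprod: "(\<Prod>k\<in>UNIV. gauss_moment (\<alpha> k)) = gauss_moment (\<alpha> i) * (\<Prod>k\<in>UNIV - {i}. gauss_moment (\<alpha> k))"
    by (subst prod.remove[of _ i]) auto
  consider "\<alpha> i = 4" | "\<alpha> i = 5" | "\<alpha> i = 6" using i sum by linarith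
  then show ?thesis
  proof cases
    case 1
    then have "sum \<alpha> (UNIV - {i}) = 2" using sum by simp
    moreover have "\<rho> ^ 6 = \<rho> ^ 4 * \<rho>\<^sup>2" by (simp flip: power_add)
    ultimately show ?thesis
      unfolding prod gprod monomial_axis[OF \<alpha>] lap sumL sumA
      using sum_falling_eq_gauss[of "UNIV - {i}" \<alpha>]
      by (simp add: 1 L_def s gauss_moment_values algebra_simps)
  next
    case 2
    then show ?thesis
      unfolding prod gprod monomial_axis[OF \<alpha>] lap sumL sumA
      by (simp add: L_def s gauss_moment_values)
  next
    case 3
    then have z: "\<alpha> k = 0" if "k \<noteq> i" for k using sum that by (auto simp: sum_eq_0_iff)
    then have "(\<Prod>k\<in>UNIV - {i}. gauss_moment (\<alpha> k)) = 1" by (auto intro!: prod.neutral)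
    then show ?thesis
      unfolding prod gprod monomial_axis[OF \<alpha>] lap sumL sumA
      using 3 z by (simp add: L_def s gauss_moment_values algebra_simps)
  qed
next
  case False
  then have le: "\<alpha> i \<le> 3" for i using not_le_imp_less[of 4 "\<alpha> i"] by auto
  have ne: "\<alpha> i \<noteq> 6" "\<alpha> i \<noteq> 4" for i using le[of i] by auto
  show ?thesis
    using le by (subst prod_low_moments[OF s(1-4)]) (auto simp: \<alpha> ne monomial_axis[OF \<alpha>] monomial_laplacian_axis[OF \<alpha>])
qed

section \<open>Theta series of harmonic polynomials of degree 2, 4 and 6\<close>

lemma Harm_coefficients:
  assumes "P \<in> Harm j"
  obtains c :: "('n::finite \<Rightarrow> nat) \<Rightarrow> real"
  where "P = (\<lambda>x. \<Sum>\<alpha>\<in>{\<alpha>. sum \<alpha> UNIV = j}. c \<alpha> * (\<Prod>i\<in>UNIV. (x $ i) ^ \<alpha> i))"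
    and "\<And>x. (\<Sum>\<alpha>\<in>{\<alpha>. sum \<alpha> UNIV = j}. c \<alpha> * monomial_laplacian \<alpha> x) = 0"
proof -
  from assms obtain c :: "('n \<Rightarrow> nat) \<Rightarrow> real"
    where c: "P = (\<lambda>x. \<Sum>\<alpha>\<in>{\<alpha>. sum \<alpha> UNIV = j}. c \<alpha> * (\<Prod>i\<in>UNIV. (x $ i) ^ \<alpha> i))"
    and "\<forall>x. laplacian P x = 0"
    by (auto simp: Harm_def homog_poly_def)
  then show ?thesis using that[of c] by (simp add: laplacian_polynomial)
qed

text \<open>Being made of point values, it is linear on functions and independent of the
  coefficients chosen to represent P.\<close>

definition axis_sum :: "(real ^ 'n::finite \<Rightarrow> real) \<Rightarrow> real" where
  "axis_sum P = (\<Sum>i\<in>UNIV. P (axis i 1))"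

lemma axis_sum_polynomial:
  "axis_sum (\<lambda>x. \<Sum>\<alpha>\<in>A. c \<alpha> * f \<alpha> x) = (\<Sum>\<alpha>\<in>A. c \<alpha> * (\<Sum>i\<in>UNIV. f \<alpha> (axis i 1)))"
  unfolding axis_sum_def by (subst sum.swap) (simp add: sum_distrib_left)

text \<open>Division of every factor by theta_3 makes the zeroth moment 1, as the moment lemmas
  require.\<close>

lemma theta_series_normalized:
  fixes c :: "('n::finite \<Rightarrow> nat) \<Rightarrow> real"
  assumes z: "Im z > 0"
  shows "theta_series (cubic_lattice :: (real ^ 'n) set) (\<lambda>x. \<Sum>\<alpha>\<in>A. c \<alpha> * (\<Prod>i\<in>UNIV. (x $ i) ^ \<alpha> i)) z
    = th3 0 z ^ CARD('n) * (\<Sum>\<alpha>\<in>A. of_real (c \<alpha>) * (\<Prod>i\<in>UNIV. th3 (\<alpha> i) z / th3 0 z))"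
  using theta_nonzero(1)[OF z]
  unfolding theta_series_polynomial[OF z] by (simp add: prod_dividef sum_divide_distrib[symmetric])

lemma theta_series_Harm2:
  fixes P :: "real ^ 'n::finite \<Rightarrow> real"
  assumes P: "P \<in> Harm 2" and z: "Im z > 0"
  shows "theta_series cubic_lattice P z = 0"
proof -
  obtain c where c: "P = (\<lambda>x. \<Sum>\<alpha>\<in>{\<alpha>. sum \<alpha> UNIV = 2}. c \<alpha> * (\<Prod>i\<in>UNIV. (x $ i) ^ \<alpha> i))"
    and h: "\<And>x. (\<Sum>\<alpha>\<in>{\<alpha>. sum \<alpha> UNIV = 2}. c \<alpha> * monomial_laplacian \<alpha> x) = 0"
    using Harm_coefficients[OF P] by blast
  define \<rho> where "\<rho> = csqrt (th3 2 z / th3 0 z)"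
  have n: "norm (1 :: complex) \<le> 1" by simp
  have "(\<Prod>i\<in>UNIV. th3 (\<alpha> i) z / th3 0 z) = \<rho>\<^sup>2 * of_real (\<Prod>i\<in>UNIV. gauss_moment (\<alpha> i))"
    if "sum \<alpha> UNIV = 2" for \<alpha> :: "'n \<Rightarrow> nat"
  proof -
    have "\<alpha> i \<le> 3" for i using member_le_sum[of i UNIV \<alpha>] that by simp
    then show ?thesis
      using prod_low_moments[of "\<lambda>a. th3 a z / th3 0 z" \<rho> UNIV \<alpha>] theta_nonzero(1)[OF z] that
        th_odd[OF n z, of 1] th_odd[OF n z, of 3] by (simp add: \<rho>_def)
  qed
  then have "theta_series cubic_lattice P z
      = th3 0 z ^ CARD('n) * \<rho>\<^sup>2 * of_real (\<Sum>\<alpha>\<in>{\<alpha>. sum \<alpha> UNIV = 2}. c \<alpha> * (\<Prod>i\<in>UNIV. gauss_moment (\<alpha> i)))"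
    unfolding c theta_series_normalized[OF z] by (simp add: sum_distrib_left mult_ac)
  then show ?thesis using harmonic_gauss_moment_zero[OF h] by simp
qed

text \<open>The second and third order equations solved for the fourth and then the sixth moment;
  theta_2^4 theta_4^4 = 16 Delta8 against the factor 8 yields the 2.\<close>

lemma theta_cumulants:
  assumes z: "Im z > 0" and \<rho>: "\<rho>\<^sup>2 = th3 2 z / th3 0 z"
  shows "th3 4 z / th3 0 z = 3 * \<rho> ^ 4 + 2 * Delta8 z"
    and "th3 6 z / th3 0 z = 15 * \<rho> ^ 6 + 15 * (2 * Delta8 z) * \<rho>\<^sup>2 + 2 * (varphi z * Delta8 z)"
proof -
  define s0 s2 s4 s6 where "s0 = th3 0 z" "s2 = th3 2 z" "s4 = th3 4 z" "s6 = th3 6 z"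
  note d = this
  have nz: "s0 \<noteq> 0" using theta_nonzero(1)[OF z] by (simp add: d)
  have s2: "s2 = \<rho>\<^sup>2 * s0" using nz \<rho> by (simp add: d)
  have "8 * (s0 * s4 - 3 * s2\<^sup>2) = 16 * Delta8 z * s0\<^sup>2"
    using theta3_second_order[OF z] by (simp add: d Delta8_def theta2_eq theta4_eq)
  then have "(8 * s0) * s4 = (8 * s0) * (s0 * (3 * \<rho> ^ 4 + 2 * Delta8 z))"
    unfolding s2 by (simp add: algebra_simps power2_eq_square power4_eq_xxxx)
  then have s4: "s4 = s0 * (3 * \<rho> ^ 4 + 2 * Delta8 z)" using nz unfolding mult_cancel_left by simp
  then show "th3 4 z / th3 0 z = 3 * \<rho> ^ 4 + 2 * Delta8 z" using nz by (simp add: d)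
  have "8 * (s6 * s0\<^sup>2 - 15 * s4 * s2 * s0 + 30 * s2 ^ 3) = 16 * (varphi z * Delta8 z) * s0 ^ 3"
    using theta3_third_order[OF z] by (simp add: d varphi_def Delta8_def theta2_eq theta4_eq)
  moreover have "\<rho> ^ 6 = \<rho>\<^sup>2 ^ 3" "\<rho> ^ 4 = \<rho>\<^sup>2 ^ 2" by simp_all
  ultimately have "(8 * s0\<^sup>2) * s6 = (8 * s0\<^sup>2) * (s0 * (15 * \<rho> ^ 6 + 15 * (2 * Delta8 z) * \<rho>\<^sup>2 + 2 * (varphi z * Delta8 z)))"
    unfolding s2 s4 by (simp only:) (simp add: algebra_simps power2_eq_square power3_eq_cube)
  then have "s6 = s0 * (15 * \<rho> ^ 6 + 15 * (2 * Delta8 z) * \<rho>\<^sup>2 + 2 * (varphi z * Delta8 z))"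
    using nz unfolding mult_cancel_left by simp
  then show "th3 6 z / th3 0 z = 15 * \<rho> ^ 6 + 15 * (2 * Delta8 z) * \<rho>\<^sup>2 + 2 * (varphi z * Delta8 z)"
    using nz by (simp add: d)
qed

lemma theta_series_Harm4:
  fixes P :: "real ^ 'n::finite \<Rightarrow> real"
  assumes P: "P \<in> Harm 4" and z: "Im z > 0"
  shows "theta_series cubic_lattice P z = of_real (2 * axis_sum P) * Delta8 z * theta3 z ^ CARD('n)"
proof -
  obtain c where c: "P = (\<lambda>x. \<Sum>\<alpha>\<in>{\<alpha>. sum \<alpha> UNIV = 4}. c \<alpha> * (\<Prod>i\<in>UNIV. (x $ i) ^ \<alpha> i))"
    and h: "\<And>x. (\<Sum>\<alpha>\<in>{\<alpha>. sum \<alpha> UNIV = 4}. c \<alpha> * monomial_laplacian \<alpha> x) = 0"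
    using Harm_coefficients[OF P] by blast
  define \<rho> where "\<rho> = csqrt (th3 2 z / th3 0 z)"
  have \<rho>: "\<rho>\<^sup>2 = th3 2 z / th3 0 z" by (simp add: \<rho>_def)
  have n: "norm (1 :: complex) \<le> 1" by simp
  have "(\<Prod>i\<in>UNIV. th3 (\<alpha> i) z / th3 0 z) = \<rho> ^ 4 * of_real (\<Prod>i\<in>UNIV. gauss_moment (\<alpha> i))
     + 2 * Delta8 z * of_real (\<Sum>i\<in>UNIV. \<Prod>k\<in>UNIV. (axis i (1::real) $ k) ^ \<alpha> k)"
    if "sum \<alpha> UNIV = 4" for \<alpha> :: "'n \<Rightarrow> nat"
    by (rule moments_degree_4[where s = "\<lambda>a. th3 a z / th3 0 z"])
       (use theta_nonzero(1)[OF z] that th_odd[OF n z] theta_cumulants(1)[OF z \<rho>] \<rho> in simp_all)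
  then have "theta_series cubic_lattice P z
      = th3 0 z ^ CARD('n) * (\<rho> ^ 4 * of_real (\<Sum>\<alpha>\<in>{\<alpha>. sum \<alpha> UNIV = 4}. c \<alpha> * (\<Prod>i\<in>UNIV. gauss_moment (\<alpha> i)))
        + 2 * Delta8 z * of_real (axis_sum P))"
    unfolding c theta_series_normalized[OF z] axis_sum_polynomial
    by (simp add: sum_distrib_left sum.distrib distrib_left mult_ac)
  then show ?thesis using harmonic_gauss_moment_zero[OF h] by (simp add: theta3_eq)
qed

lemma theta_series_Harm6:
  fixes P :: "real ^ 'n::finite \<Rightarrow> real"
  assumes P: "P \<in> Harm 6" and z: "Im z > 0"
  shows "theta_series cubic_lattice P z = of_real (2 * axis_sum P) * varphi z * Delta8 z * theta3 z ^ CARD('n)"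
proof -
  obtain c where c: "P = (\<lambda>x. \<Sum>\<alpha>\<in>{\<alpha>. sum \<alpha> UNIV = 6}. c \<alpha> * (\<Prod>i\<in>UNIV. (x $ i) ^ \<alpha> i))"
    and h: "\<And>x. (\<Sum>\<alpha>\<in>{\<alpha>. sum \<alpha> UNIV = 6}. c \<alpha> * monomial_laplacian \<alpha> x) = 0"
    using Harm_coefficients[OF P] by blast
  define \<rho> where "\<rho> = csqrt (th3 2 z / th3 0 z)"
  have \<rho>: "\<rho>\<^sup>2 = th3 2 z / th3 0 z" by (simp add: \<rho>_def)
  have n: "norm (1 :: complex) \<le> 1" by simp
  have "(\<Prod>i\<in>UNIV. th3 (\<alpha> i) z / th3 0 z) = \<rho> ^ 6 * of_real (\<Prod>i\<in>UNIV. gauss_moment (\<alpha> i))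
     + 2 * (varphi z * Delta8 z) * of_real (\<Sum>i\<in>UNIV. \<Prod>k\<in>UNIV. (axis i (1::real) $ k) ^ \<alpha> k)
     + 2 * Delta8 z * \<rho>\<^sup>2 / 2 * of_real (\<Sum>i\<in>UNIV. monomial_laplacian \<alpha> (axis i 1))"
    if "sum \<alpha> UNIV = 6" for \<alpha> :: "'n \<Rightarrow> nat"
    by (rule moments_degree_6[where s = "\<lambda>a. th3 a z / th3 0 z"])
       (use theta_nonzero(1)[OF z] that th_odd[OF n z] theta_cumulants[OF z \<rho>] \<rho> in simp_all)
  then have "theta_series cubic_lattice P z
      = th3 0 z ^ CARD('n) * (\<rho> ^ 6 * of_real (\<Sum>\<alpha>\<in>{\<alpha>. sum \<alpha> UNIV = 6}. c \<alpha> * (\<Prod>i\<in>UNIV. gauss_moment (\<alpha> i)))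
        + 2 * (varphi z * Delta8 z) * of_real (axis_sum P)
        + 2 * Delta8 z * \<rho>\<^sup>2 / 2 * of_real (axis_sum (\<lambda>x. \<Sum>\<alpha>\<in>{\<alpha>. sum \<alpha> UNIV = 6}. c \<alpha> * monomial_laplacian \<alpha> x)))"
    unfolding c theta_series_normalized[OF z] axis_sum_polynomial
    by (simp add: sum_distrib_left sum.distrib distrib_left mult_ac)
  \<comment> \<open>The Gaussian term and the sum of the Laplacian over the e_i both vanish for
    harmonic P, so only the sixth cumulant is left.\<close>
  then show ?thesis using harmonic_gauss_moment_zero[OF h] by (simp add: theta3_eq h axis_sum_def)
qed

section \<open>Vanishing of the linear forms in low dimension\<close>

lemma axis_sum_Harm_dim1:
  fixes P :: "real ^ 'n::finite \<Rightarrow> real"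
  assumes P: "P \<in> Harm j" and n: "CARD('n) = 1" and j: "j = 4 \<or> j = 6"
  shows "axis_sum P = 0"
proof -
  obtain c where c: "P = (\<lambda>x. \<Sum>\<alpha>\<in>{\<alpha>. sum \<alpha> UNIV = j}. c \<alpha> * (\<Prod>i\<in>UNIV. (x $ i) ^ \<alpha> i))"
    and h: "\<And>x. (\<Sum>\<alpha>\<in>{\<alpha>. sum \<alpha> UNIV = j}. c \<alpha> * monomial_laplacian \<alpha> x) = 0"
    using Harm_coefficients[OF P] by blast
  obtain i where U: "(UNIV :: 'n set) = {i}" using n by (auto simp: card_1_singleton_iff)
  \<comment> \<open>In one variable x^j is the only monomial, so the Gaussian functional is a
    nonzero multiple of evaluation at 1.\<close>
  have "(\<Prod>k\<in>UNIV. gauss_moment (\<alpha> k)) = gauss_moment j * (\<Sum>i\<in>UNIV. \<Prod>k\<in>UNIV. (axis i (1::real) $ k) ^ \<alpha> k)"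
    if "sum \<alpha> UNIV = j" for \<alpha> :: "'n \<Rightarrow> nat"
    using that by (simp add: U axis_def)
  then have "0 = gauss_moment j * axis_sum P"
    using harmonic_gauss_moment_zero[OF h] j
    unfolding c axis_sum_polynomial by (auto simp: sum_distrib_left mult_ac)
  moreover have "gauss_moment j \<noteq> 0" using j by (auto simp: gauss_moment_values)
  ultimately show ?thesis by simp
qed

text \<open>This reflects i^6 = -1: the real part of (x + i y)^6 takes the values 1 and -1 at the
  two coordinate vectors. The proof instead expresses \<open>axis_sum\<close> through two
  functionals that vanish on harmonic polynomials.\<close>

lemma axis_sum_Harm6_dim2:
  fixes P :: "real ^ 'n::finite \<Rightarrow> real"
  assumes P: "P \<in> Harm 6" and n: "CARD('n) = 2"
  shows "axis_sum P = 0"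
proof -
  obtain c where c: "P = (\<lambda>x. \<Sum>\<alpha>\<in>{\<alpha>. sum \<alpha> UNIV = 6}. c \<alpha> * (\<Prod>i\<in>UNIV. (x $ i) ^ \<alpha> i))"
    and h: "\<And>x. (\<Sum>\<alpha>\<in>{\<alpha>. sum \<alpha> UNIV = 6}. c \<alpha> * monomial_laplacian \<alpha> x) = 0"
    using Harm_coefficients[OF P] by blast
  obtain i j where ij: "i \<noteq> j" and U: "(UNIV :: 'n set) = {i, j}" using n by (auto simp: card_2_iff)
  \<comment> \<open>The coefficients come from x^6 and x^4 y^2: 15 = 3/2 * 30 - 30 and 3 = 3/2 * 2.
    On monomials with odd exponents all terms vanish.\<close>
  have "(\<Prod>k\<in>UNIV. gauss_moment (\<alpha> k)) = 3/2 * (\<Sum>i\<in>UNIV. monomial_laplacian \<alpha> (axis i 1))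
      - 30 * (\<Sum>i\<in>UNIV. \<Prod>k\<in>UNIV. (axis i (1::real) $ k) ^ \<alpha> k)"
    if \<alpha>: "sum \<alpha> UNIV = 6" for \<alpha> :: "'n \<Rightarrow> nat"
  proof -
    have sum: "\<alpha> i + \<alpha> j = 6" using \<alpha> ij by (simp add: U)
    have diff: "{i, j} - {i} = {j}" "{i, j} - {j} = {i}" using ij by auto
    have "\<alpha> i = 0 \<or> \<alpha> i = 1 \<or> \<alpha> i = 2 \<or> \<alpha> i = 3 \<or> \<alpha> i = 4 \<or> \<alpha> i = 5 \<or> \<alpha> i = 6"
      using sum by linarith
    then show ?thesis
      using sum ij unfolding monomial_axis[OF \<alpha>] monomial_laplacian_axis[OF \<alpha>, simplified]
      by (elim disjE) (simp_all add: U diff gauss_moment_values)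
  qed
  then have "(\<Sum>\<alpha>\<in>{\<alpha>. sum \<alpha> UNIV = 6}. c \<alpha> * (\<Prod>i\<in>UNIV. gauss_moment (\<alpha> i)))
     = 3/2 * axis_sum (\<lambda>x. \<Sum>\<alpha>\<in>{\<alpha>. sum \<alpha> UNIV = 6}. c \<alpha> * monomial_laplacian \<alpha> x) - 30 * axis_sum P"
    unfolding c axis_sum_polynomial by (simp add: sum_distrib_left sum_subtractf right_diff_distrib mult_ac)
  then show ?thesis using harmonic_gauss_moment_zero[OF h] by (simp add: h axis_sum_def)
qed

section \<open>Harmonic polynomials with nonzero axis sum\<close>

lemma homog_poly_monomial:
  assumes "sum \<beta> UNIV = j"
  shows "homog_poly j (\<lambda>x :: real ^ 'n::finite. \<Prod>i\<in>UNIV. (x $ i) ^ \<beta> i)"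
  unfolding homog_poly_def
proof (intro exI[of _ "\<lambda>\<alpha>. if \<alpha> = \<beta> then 1 else 0"] ext)
  fix x :: "real ^ 'n"
  have "(\<Sum>\<alpha>\<in>{\<alpha>. sum \<alpha> UNIV = j}. (if \<alpha> = \<beta> then 1 else 0) * (\<Prod>i\<in>UNIV. (x $ i) ^ \<alpha> i))
      = (\<Sum>\<alpha>\<in>{\<alpha>. sum \<alpha> UNIV = j}. if \<alpha> = \<beta> then \<Prod>i\<in>UNIV. (x $ i) ^ \<alpha> i else 0)"
    by (intro sum.cong) auto
  also have "\<dots> = (\<Prod>i\<in>UNIV. (x $ i) ^ \<beta> i)"
    using assms by (simp add: finite_multi_indices)
  finally show "(\<Prod>i\<in>UNIV. (x $ i) ^ \<beta> i)
      = (\<Sum>\<alpha>\<in>{\<alpha>. sum \<alpha> UNIV = j}. (if \<alpha> = \<beta> then 1 else 0) * (\<Prod>i\<in>UNIV. (x $ i) ^ \<alpha> i))" ..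
qed

lemma homog_poly_add:
  assumes "homog_poly j P" "homog_poly j Q"
  shows "homog_poly j (\<lambda>x. P x + Q x)"
proof -
  obtain c d where "P = (\<lambda>x. \<Sum>\<alpha>\<in>{\<alpha>. sum \<alpha> UNIV = j}. c \<alpha> * (\<Prod>i\<in>UNIV. (x $ i) ^ \<alpha> i))"
    "Q = (\<lambda>x. \<Sum>\<alpha>\<in>{\<alpha>. sum \<alpha> UNIV = j}. d \<alpha> * (\<Prod>i\<in>UNIV. (x $ i) ^ \<alpha> i))"
    using assms unfolding homog_poly_def by blast
  then show ?thesis unfolding homog_poly_def
    by (intro exI[of _ "\<lambda>\<alpha>. c \<alpha> + d \<alpha>"]) (simp add: sum.distrib distrib_right)
qed

lemma homog_poly_cmult:
  assumes "homog_poly j P"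
  shows "homog_poly j (\<lambda>x. a * P x)"
proof -
  obtain c where "P = (\<lambda>x. \<Sum>\<alpha>\<in>{\<alpha>. sum \<alpha> UNIV = j}. c \<alpha> * (\<Prod>i\<in>UNIV. (x $ i) ^ \<alpha> i))"
    using assms unfolding homog_poly_def by blast
  then show ?thesis unfolding homog_poly_def
    by (intro exI[of _ "\<lambda>\<alpha>. a * c \<alpha>"]) (simp add: sum_distrib_left mult_ac)
qed

lemma homog_poly_monomial2:
  assumes "i \<noteq> j" "a + b = d"
  shows "homog_poly d (\<lambda>x :: real ^ 'n::finite. (x $ i) ^ a * (x $ j) ^ b)"
proof -
  let ?\<beta> = "(\<lambda>_. 0)(i := a, j := b)"
  have "(\<Prod>k\<in>UNIV. (x $ k) ^ ?\<beta> k) = (x $ i) ^ a * (x $ j) ^ b" for x :: "real ^ 'n"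
    using assms by (subst prod.mono_neutral_right[of UNIV "{i, j}"]) auto
  moreover have "sum ?\<beta> UNIV = d"
    using assms by (subst sum.mono_neutral_right[of UNIV "{i, j}"]) auto
  ultimately show ?thesis using homog_poly_monomial[of ?\<beta> d] by simp
qed

lemma homog_poly_monomial3:
  assumes "i \<noteq> j" "i \<noteq> k" "j \<noteq> k" "a + b + c = d"
  shows "homog_poly d (\<lambda>x :: real ^ 'n::finite. (x $ i) ^ a * (x $ j) ^ b * (x $ k) ^ c)"
proof -
  let ?\<beta> = "(\<lambda>_. 0)(i := a, j := b, k := c)"
  have "(\<Prod>m\<in>UNIV. (x $ m) ^ ?\<beta> m) = (x $ i) ^ a * (x $ j) ^ b * (x $ k) ^ c" for x :: "real ^ 'n"
    using assms by (subst prod.mono_neutral_right[of UNIV "{i, j, k}"]) (auto simp: mult_ac)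
  moreover have "sum ?\<beta> UNIV = d"
    using assms by (subst sum.mono_neutral_right[of UNIV "{i, j, k}"]) auto
  ultimately show ?thesis using homog_poly_monomial[of ?\<beta> d] by simp
qed

lemma ex_Harm4_axis_sum_nonzero:
  assumes "CARD('n::finite) \<ge> 2"
  shows "\<exists>P \<in> (Harm 4 :: (real ^ 'n \<Rightarrow> real) set). axis_sum P \<noteq> 0"
proof -
  obtain S :: "'n set" where "card S = 2" using obtain_subset_with_card_n[OF assms] by metis
  then obtain i j :: 'n where ij: "i \<noteq> j" unfolding card_2_iff by blast
  \<comment> \<open>This is Re (a + i b)^4, with value 1 at both coordinate vectors; it is bracketed
    to match \<open>homog_poly_add\<close> and \<open>homog_poly_cmult\<close>.\<close>
  define p where "p a b = a ^ 4 + ((-6) * (a ^ 2 * b ^ 2) + b ^ 4)" for a b :: real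
  define P where "P x = p (x $ i) (x $ j)" for x :: "real ^ 'n"
  have sym: "p a b = p b a" for a b by (simp add: p_def algebra_simps)
  have d: "deriv (\<lambda>s. deriv (\<lambda>t. p (a + t) b) s) 0 = 12 * a\<^sup>2 - 12 * b\<^sup>2" for a b
  proof -
    have "deriv (\<lambda>t. p (a + t) b) = (\<lambda>s. 4 * (a + s) ^ 3 - 12 * (a + s) * b\<^sup>2)"
      unfolding p_def
      by (rule ext, rule DERIV_imp_deriv) (auto intro!: derivative_eq_intros)
    moreover have "deriv (\<lambda>s. 4 * (a + s) ^ 3 - 12 * (a + s) * b\<^sup>2) 0 = 12 * a\<^sup>2 - 12 * b\<^sup>2"
      by (rule DERIV_imp_deriv) (auto intro!: derivative_eq_intros)
    ultimately show ?thesis by simp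
  qed
  have "laplacian P x = 0" for x
  proof -
    define f where "f k = deriv (\<lambda>s. deriv (\<lambda>t. P (x + t *\<^sub>R axis k 1)) s) 0" for k
    have 0: "f k = 0" if "k \<noteq> i" "k \<noteq> j" for k using that by (simp add: f_def P_def axis_def)
    have i: "f i = 12 * (x $ i)\<^sup>2 - 12 * (x $ j)\<^sup>2"
      using ij d[of "x $ i" "x $ j"] by (simp add: f_def P_def axis_def)
    have j: "f j = 12 * (x $ j)\<^sup>2 - 12 * (x $ i)\<^sup>2"
      using ij d[of "x $ j" "x $ i"] by (simp add: f_def P_def axis_def sym[of "x $ i"])
    have "laplacian P x = (\<Sum>k\<in>UNIV. f k)" by (simp add: laplacian_def f_def)
    also have "\<dots> = (\<Sum>k\<in>{i, j}. f k)" by (rule sum.mono_neutral_right) (auto simp: 0)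
    also have "\<dots> = 0" using ij by (simp add: i j)
    finally show ?thesis .
  qed
  moreover have "homog_poly 4 P"
    using homog_poly_add[OF homog_poly_monomial2[OF ij, of 4 0 4]
        homog_poly_add[OF homog_poly_cmult[OF homog_poly_monomial2[OF ij, of 2 2 4], of "-6"] homog_poly_monomial2[OF ij, of 0 4 4]]]
    by (simp add: P_def[abs_def] p_def)
  ultimately have "P \<in> Harm 4" by (simp add: Harm_def)
  moreover have "axis_sum P = 2"
  proof -
    have "axis_sum P = (\<Sum>k\<in>{i, j}. P (axis k 1))"
      unfolding axis_sum_def by (rule sum.mono_neutral_right) (auto simp: P_def p_def axis_def)
    then show ?thesis using ij by (simp add: P_def p_def axis_def)
  qed
  ultimately show ?thesis by (intro bexI[of _ P]) auto
qed

lemma ex_Harm6_axis_sum_nonzero: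
  assumes "CARD('n::finite) \<ge> 3"
  shows "\<exists>P \<in> (Harm 6 :: (real ^ 'n \<Rightarrow> real) set). axis_sum P \<noteq> 0"
proof -
  obtain S :: "'n set" where "card S = 3" using obtain_subset_with_card_n[OF assms] by metis
  then obtain i j k :: 'n where ijk: "i \<noteq> j" "i \<noteq> k" "j \<noteq> k" by (metis card_3_iff)
  \<comment> \<open>An even symmetric sextic; harmonicity fixes the ratio 2 : -15 : 180 through 30 *
    2 + 4 * (-15) = 0 and 24 * (-15) + 2 * 180 = 0.\<close>
  define p where "p a b c = 2 * a ^ 6 + (2 * b ^ 6 + (2 * c ^ 6 + ((-15) * (a ^ 4 * b ^ 2) + ((-15) * (a ^ 2 * b ^ 4)
      + ((-15) * (a ^ 4 * c ^ 2) + ((-15) * (a ^ 2 * c ^ 4) + ((-15) * (b ^ 4 * c ^ 2)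
      + ((-15) * (b ^ 2 * c ^ 4) + 180 * (a ^ 2 * b ^ 2 * c ^ 2)))))))))" for a b c :: real
  define P where "P x = p (x $ i) (x $ j) (x $ k)" for x :: "real ^ 'n"
  \<comment> \<open>The second derivative of p in its first argument; cyclic symmetry supplies the
    other two.\<close>
  define D where "D a b c = 60 * a ^ 4 - 180 * a\<^sup>2 * b\<^sup>2 - 30 * b ^ 4 - 180 * a\<^sup>2 * c\<^sup>2 - 30 * c ^ 4 + 360 * b\<^sup>2 * c\<^sup>2"
    for a b c :: real
  have sym: "p a b c = p b c a" "p a b c = p c a b" for a b c by (simp_all add: p_def algebra_simps)
  have d: "deriv (\<lambda>s. deriv (\<lambda>t. p (a + t) b c) s) 0 = D a b c" for a b c
  proof -
    have "deriv (\<lambda>t. p (a + t) b c) = (\<lambda>s. 12 * (a + s) ^ 5 - 60 * (a + s) ^ 3 * b\<^sup>2 - 30 * (a + s) * b ^ 4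
        - 60 * (a + s) ^ 3 * c\<^sup>2 - 30 * (a + s) * c ^ 4 + 360 * (a + s) * b\<^sup>2 * c\<^sup>2)"
      unfolding p_def
      by (rule ext, rule DERIV_imp_deriv) (auto intro!: derivative_eq_intros simp: algebra_simps)
    moreover have "deriv (\<lambda>s. 12 * (a + s) ^ 5 - 60 * (a + s) ^ 3 * b\<^sup>2 - 30 * (a + s) * b ^ 4
        - 60 * (a + s) ^ 3 * c\<^sup>2 - 30 * (a + s) * c ^ 4 + 360 * (a + s) * b\<^sup>2 * c\<^sup>2) 0 = D a b c"
      unfolding D_def
      by (rule DERIV_imp_deriv) (auto intro!: derivative_eq_intros simp: algebra_simps)
    ultimately show ?thesis by simp
  qed
  have "laplacian P x = 0" for x
  proof -
    define f where "f m = deriv (\<lambda>s. deriv (\<lambda>t. P (x + t *\<^sub>R axis m 1)) s) 0" for m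
    have 0: "f m = 0" if "m \<noteq> i" "m \<noteq> j" "m \<noteq> k" for m using that by (simp add: f_def P_def axis_def)
    have i: "f i = D (x $ i) (x $ j) (x $ k)"
      using ijk d[of "x $ i" "x $ j" "x $ k"] by (simp add: f_def P_def axis_def)
    have j: "f j = D (x $ j) (x $ k) (x $ i)"
      using ijk d[of "x $ j" "x $ k" "x $ i"] by (simp add: f_def P_def axis_def sym(1)[of "x $ i"])
    have k: "f k = D (x $ k) (x $ i) (x $ j)"
      using ijk d[of "x $ k" "x $ i" "x $ j"] by (simp add: f_def P_def axis_def sym(2)[of "x $ i"])
    have "laplacian P x = (\<Sum>m\<in>UNIV. f m)" by (simp add: laplacian_def f_def)
    also have "\<dots> = (\<Sum>m\<in>{i, j, k}. f m)" by (rule sum.mono_neutral_right) (auto simp: 0)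
    also have "\<dots> = 0" using ijk by (simp add: i j k D_def)
    finally show ?thesis .
  qed
  moreover have "homog_poly 6 P"
  proof -
    note m = homog_poly_monomial3[OF ijk, where d = 6]
    have "homog_poly 6 (\<lambda>x. (x $ i) ^ 6)" "homog_poly 6 (\<lambda>x. (x $ j) ^ 6)" "homog_poly 6 (\<lambda>x. (x $ k) ^ 6)"
      "homog_poly 6 (\<lambda>x. (x $ i) ^ 4 * (x $ j) ^ 2)" "homog_poly 6 (\<lambda>x. (x $ i) ^ 2 * (x $ j) ^ 4)"
      "homog_poly 6 (\<lambda>x. (x $ i) ^ 4 * (x $ k) ^ 2)" "homog_poly 6 (\<lambda>x. (x $ i) ^ 2 * (x $ k) ^ 4)"
      "homog_poly 6 (\<lambda>x. (x $ j) ^ 4 * (x $ k) ^ 2)" "homog_poly 6 (\<lambda>x. (x $ j) ^ 2 * (x $ k) ^ 4)"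
      "homog_poly 6 (\<lambda>x. (x $ i) ^ 2 * (x $ j) ^ 2 * (x $ k) ^ 2)"
      using m[of 6 0 0] m[of 0 6 0] m[of 0 0 6] m[of 4 2 0] m[of 2 4 0] m[of 4 0 2] m[of 2 0 4] m[of 0 4 2] m[of 0 2 4] m[of 2 2 2]
      by simp_all
    then show ?thesis
      unfolding P_def[abs_def] p_def by (intro homog_poly_add homog_poly_cmult)
  qed
  ultimately have "P \<in> Harm 6" by (simp add: Harm_def)
  moreover have "axis_sum P = 6"
  proof -
    have "axis_sum P = (\<Sum>m\<in>{i, j, k}. P (axis m 1))"
      unfolding axis_sum_def by (rule sum.mono_neutral_right) (auto simp: P_def p_def axis_def)
    then show ?thesis using ijk by (simp add: P_def p_def axis_def)
  qed
  ultimately show ?thesis by (intro bexI[of _ P]) auto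
qed

lemma linear_form_axis_sum:
  fixes V :: "(real ^ 'n::finite \<Rightarrow> real) set"
  shows "linear_form_on V (\<lambda>P. 2 * axis_sum P)"
proof -
  have "axis_sum (\<lambda>x. a * P x + b * Q x) = a * axis_sum P + b * axis_sum Q"
    for a b and P Q :: "real ^ 'n \<Rightarrow> real"
    by (simp add: axis_sum_def sum.distrib sum_distrib_left)
  then show ?thesis by (simp add: linear_form_on_def distrib_left mult.left_commute)
qed

theorem lemma9p1:
  shows "(\<forall>z. Im z > 0 \<longrightarrow>
            theta_series (cubic_lattice :: (real ^ 'n) set) (\<lambda>_. 1) z = theta3 z ^ CARD('n))
    \<and> (\<forall>P \<in> (Harm 2 :: (real ^ 'n \<Rightarrow> real) set). \<forall>z. Im z > 0 \<longrightarrow>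
            theta_series (cubic_lattice :: (real ^ 'n) set) P z = 0)
    \<and> (\<exists>c1. linear_form_on (Harm 4 :: (real ^ 'n \<Rightarrow> real) set) c1
         \<and> (\<forall>P \<in> (Harm 4 :: (real ^ 'n \<Rightarrow> real) set). \<forall>z. Im z > 0 \<longrightarrow>
              theta_series (cubic_lattice :: (real ^ 'n) set) P z
                = of_real (c1 P) * Delta8 z * theta3 z ^ CARD('n))
         \<and> ((\<exists>P \<in> (Harm 4 :: (real ^ 'n \<Rightarrow> real) set). c1 P \<noteq> 0) \<longleftrightarrow> CARD('n) \<ge> 2))
    \<and> (\<exists>c2. linear_form_on (Harm 6 :: (real ^ 'n \<Rightarrow> real) set) c2
         \<and> (\<forall>P \<in> (Harm 6 :: (real ^ 'n \<Rightarrow> real) set). \<forall>z. Im z > 0 \<longrightarrow>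
              theta_series (cubic_lattice :: (real ^ 'n) set) P z
                = of_real (c2 P) * varphi z * Delta8 z * theta3 z ^ CARD('n))
         \<and> ((\<exists>P \<in> (Harm 6 :: (real ^ 'n \<Rightarrow> real) set). c2 P \<noteq> 0) \<longleftrightarrow> CARD('n) \<ge> 3))"
\<comment> \<open>One formula serves for both linear forms; the 2 comes from the cumulants 2 Delta8
  and 2 varphi Delta8.\<close>
proof (intro conjI exI[of _ "\<lambda>P. 2 * axis_sum P"] linear_form_axis_sum)
  have card: "CARD('n) \<ge> 1" using zero_less_card_finite[where 'a = 'n] by linarith
  show "\<forall>z. Im z > 0 \<longrightarrow> theta_series (cubic_lattice :: (real ^ 'n) set) (\<lambda>_. 1) z = theta3 z ^ CARD('n)"
    using theta_series_polynomial[where A = "{\<lambda>_ :: 'n. 0}" and c = "\<lambda>_. 1"] by (simp add: theta3_eq)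
  show "\<forall>P \<in> (Harm 2 :: (real ^ 'n \<Rightarrow> real) set). \<forall>z. Im z > 0 \<longrightarrow>
            theta_series (cubic_lattice :: (real ^ 'n) set) P z = 0"
    by (blast intro: theta_series_Harm2)
  show "\<forall>P \<in> (Harm 4 :: (real ^ 'n \<Rightarrow> real) set). \<forall>z. Im z > 0 \<longrightarrow>
      theta_series (cubic_lattice :: (real ^ 'n) set) P z
        = of_real (2 * axis_sum P) * Delta8 z * theta3 z ^ CARD('n)"
    by (blast intro: theta_series_Harm4)
  show "\<forall>P \<in> (Harm 6 :: (real ^ 'n \<Rightarrow> real) set). \<forall>z. Im z > 0 \<longrightarrow>
      theta_series (cubic_lattice :: (real ^ 'n) set) P z
        = of_real (2 * axis_sum P) * varphi z * Delta8 z * theta3 z ^ CARD('n)"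
    by (blast intro: theta_series_Harm6)
  show "(\<exists>P \<in> (Harm 4 :: (real ^ 'n \<Rightarrow> real) set). 2 * axis_sum P \<noteq> 0) \<longleftrightarrow> CARD('n) \<ge> 2"
  proof
    assume "\<exists>P \<in> (Harm 4 :: (real ^ 'n \<Rightarrow> real) set). 2 * axis_sum P \<noteq> 0"
    then have "CARD('n) \<noteq> 1" using axis_sum_Harm_dim1[where 'n = 'n and j = 4] by auto
    then show "CARD('n) \<ge> 2" using card by linarith
  qed (use ex_Harm4_axis_sum_nonzero in auto)
  show "(\<exists>P \<in> (Harm 6 :: (real ^ 'n \<Rightarrow> real) set). 2 * axis_sum P \<noteq> 0) \<longleftrightarrow> CARD('n) \<ge> 3"
  proof
    assume "\<exists>P \<in> (Harm 6 :: (real ^ 'n \<Rightarrow> real) set). 2 * axis_sum P \<noteq> 0"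
    then have "CARD('n) \<noteq> 1" "CARD('n) \<noteq> 2"
      using axis_sum_Harm_dim1[where 'n = 'n and j = 6] axis_sum_Harm6_dim2[where 'n = 'n] by auto
    then show "CARD('n) \<ge> 3" using card by linarith
  qed (use ex_Harm6_axis_sum_nonzero in auto)
qed

end
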